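(* Let $\mathfrak{g}=\mathfrak{g}(A,\tau)$ be a symmetrizable contragredient Lie superalgebra over $\mathbb{C}$ with fixed form $(\cdot,\cdot)$ and fixed $\rho$ (all as in the context), and let $B$ be an associative, commutative, finitely generated $\mathbb{C}$-algebra with unity. For $a,b\in B$ let $$\Omega(a,b)=2h_\rho(ab)+\sum_i h_i(a)h^i(b)+\sum_{\alpha\in\Delta^+}\Omega_\alpha(a,b)+\sum_{\alpha\in\Delta^+}\Omega_\alpha(b,a),\qquad \Omega_\alpha(a,b)=\sum_i f_\alpha^i(a)\,e_\alpha^i(b).$$ Then for all $a,b\in B$ the operator $\Omega(a,b)$ is central: for every $\mathfrak{g}\otimes B$-module $V$ in the category $\mathcal{O}$, the linear map defined by $\Omega(a,b)$ on $V$ commutes with the action of $\mathfrak{g}\cong\mathfrak{g}\otimes\mathbb{C}1\subseteq\mathfrak{g}\otimes B$ on $V$.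
   Context: Everything is over $\mathbb{C}$; $|x|\in\mathbb{Z}_2$ is the parity of a homogeneous element $x$. **Contragredient Lie superalgebras.** Let $I=\{1,\dots,l\}$, $\tau\subseteq I$, $A=(a_{ij})_{i,j\in I}$ a complex matrix, $\mathfrak{h}$ a complex vector space of dimension $l+\operatorname{corank}A$, with linearly independent sets $\{\alpha_1,\dots,\alpha_l\}\subseteq\mathfrak{h}^*$ and $\{\alpha_1^\vee,\dots,\alpha_l^\vee\}\subseteq\mathfrak{h}$ such that $\alpha_j(\alpha_i^\vee)=a_{ij}$. Let $\widetilde{\mathfrak{g}}(A,\tau)$ be the Lie superalgebra generated by $\mathfrak{h}$ and $e_i,f_i$ ($i\in I$) with relations $[e_i,f_j]=\delta_{ij}\alpha_i^\vee$, $[h,e_j]=\alpha_j(h)e_j$, $[h,f_j]=-\alpha_j(h)f_j$, $[h,h']=0$ ($h,h'\in\mathfrak{h}$), where $e_i,f_i$ are odd if $i\in\tau$ and even if $i\notin\tau$, and $\mathfrak{h}$ is even. Let $R$ be the maximal ideal among the ideals intersecting $\mathfrak{h}$ trivially, and $\mathfrak{g}=\mathfrak{g}(A,\tau)=\widetilde{\mathfrak{g}}(A,\tau)/R$. Then $\mathfrak{g}=\mathfrak{h}\oplus\bigoplus_{\alpha\in\Delta}\mathfrak{g}_\alpha$, where $\mathfrak{g}_\alpha=\{x:[h,x]=\alpha(h)x\ \forall h\in\mathfrak{h}\}$ and $\Delta$ is the set of nonzero $\alpha\in\mathfrak{h}^*$ with $\mathfrak{g}_\alpha\ne0$ (roots);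 each $\mathfrak{g}_\alpha$ is finite-dimensional and homogeneous of a parity $|\alpha|$; $\Delta=\Delta^+\sqcup\Delta^-$, where $\Delta^+$ (resp. $\Delta^-$) consists of the roots that are nonnegative (resp. nonpositive) integer combinations of the simple roots $\alpha_1,\dots,\alpha_l$. For $\alpha=\sum m_i\alpha_i\in\Delta^+$, $\operatorname{ht}(\alpha)=\sum m_i$. **Form.** $A$ is assumed symmetrizable: there is a diagonal matrix $D$ with nonzero diagonal entries such that $AD$ is symmetric. Then $\mathfrak{g}$ carries a non-degenerate bilinear form $(\cdot,\cdot)$, which we fix, such that: it is non-degenerate on $\mathfrak{h}$; it is invariant, $([x,y],z)=(x,[y,z])$; it is super-symmetric, $(x,y)=(-1)^{|x||y|}(y,x)$; $(\mathfrak{g}_\alpha,\mathfrak{g}_\beta)\neq0$ implies $\alpha+\beta=0$, and the pairing of $\mathfrak{g}_\alpha$ with $\mathfrak{g}_{-\alpha}$ is non-degenerate; it is even, $(\mathfrak{g}_{\bar0},\mathfrak{g}_{\bar1})=0=(\mathfrak{g}_{\bar1},\mathfrak{g}_{\bar0})$. For $\alpha\in\mathfrak{h}^*$ let $h_\alpha\in\mathfrak{h}$ be the unique element with $(h_\alpha,h)=\alpha(h)$ for all $h\in\mathfrak{h}$, and put $(\alpha,\beta)=(h_\alpha,h_\beta)$ on $\mathfrak{h}^*$. Fix $\rho\in\mathfrak{h}^*$ with $2(\rho,\alpha_i)=(\alpha_i,\alpha_i)$ for all $i$. **Bases.** $\{h_i\}$ is a basis of $\mathfrak{h}$ and $\{h^i\}$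 the dual basis of $\mathfrak{h}$, $(h_i,h^j)=\delta_{ij}$. For $\alpha\in\Delta^+$, $\{e_\alpha^i\}$ is a basis of $\mathfrak{g}_\alpha$ and $\{f_\alpha^i\}$ the dual basis of $\mathfrak{g}_{-\alpha}$, $(e_\alpha^i,f_\alpha^j)=\delta_{ij}$. **Loop algebra and category $\mathcal{O}$.** $\mathfrak{g}\otimes B$ is the Lie superalgebra with bracket $[x\otimes a,y\otimes b]=[x,y]\otimes ab$ and $\mathbb{Z}_2$-grading from $\mathfrak{g}$; write $x(a)=x\otimes a$. A $\mathfrak{g}\otimes B$-module $V$ is in $\mathcal{O}$ if (1) $V=\bigoplus_{\lambda\in\mathfrak{h}^*}V_\lambda$ with $V_\lambda=\{v: h.v=\lambda(h)v\ \forall h\in\mathfrak{h}\}$ and $\dim V_\lambda<\infty$; (2) for any $v\in V$ and $a\in B$, $(x_\alpha\otimes a).v=0$ for all $x_\alpha\in\mathfrak{g}_\alpha$, $\alpha\in\Delta^+$, with $\operatorname{ht}(\alpha)$ sufficiently large (depending on $v,a$). On such $V$ the possibly infinite sum $\Omega(a,b)$ acts as a well-defined linear map, since only finitely many terms are nonzero on each vector. *)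

theory Defs
  imports
    "HOL-Analysis.Cartesian_Space"
    "HOL-Library.Function_Algebras"
    "HOL-Library.Poly_Mapping"
    "HOL-Library.Z2"
begin

text \<open>
  Parities are elements of the field \<open>bit\<close> with two elements. Vector spaces are whole types with
  an explicit scalar multiplication, as in the library locale \<open>vector_space\<close>.
  The algebras \<open>g~(A,\<tau>)\<close>, \<open>g(A,\<tau>)\<close> and \<open>g \<otimes> B\<close> are not singled out as particular types: a
  type with operations stands for one of them when it is isomorphic to the textbook quotient
  construction, the isomorphism being expressed by a surjective evaluation map with the
  prescribed kernel.
\<close>

definition is_basis ::
  "(complex \<Rightarrow> 'a::ab_group_add \<Rightarrow> 'a) \<Rightarrow> nat \<Rightarrow> (nat \<Rightarrow> 'a) \<Rightarrow> 'a set \<Rightarrow> bool" where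
  "is_basis s n b S \<longleftrightarrow>
     inj_on b {..<n} \<and> \<not> module.dependent s (b ` {..<n}) \<and> module.span s (b ` {..<n}) = S"

definition is_direct_sum ::
  "(complex \<Rightarrow> 'a::ab_group_add \<Rightarrow> 'a) \<Rightarrow> 'k set \<Rightarrow> ('k \<Rightarrow> 'a set) \<Rightarrow> bool" where
  "is_direct_sum s K W \<longleftrightarrow>
     (\<forall>k\<in>K. module.subspace s (W k)) \<and>
     (\<forall>v. \<exists>!u. (\<forall>k\<in>K. u k \<in> W k) \<and> (\<forall>k. k \<notin> K \<longrightarrow> u k = 0) \<and>
            finite {k. u k \<noteq> 0} \<and> v = (\<Sum>k | u k \<noteq> 0. u k))"

definition bilinear_map ::
  "(complex \<Rightarrow> 'a::ab_group_add \<Rightarrow> 'a) \<Rightarrow> (complex \<Rightarrow> 'b::ab_group_add \<Rightarrow> 'b) \<Rightarrow>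
   (complex \<Rightarrow> 'c::ab_group_add \<Rightarrow> 'c) \<Rightarrow> ('a \<Rightarrow> 'b \<Rightarrow> 'c) \<Rightarrow> bool" where
  "bilinear_map s1 s2 s3 \<beta> \<longleftrightarrow>
     (\<forall>x. Vector_Spaces.linear s2 s3 (\<beta> x)) \<and> (\<forall>y. Vector_Spaces.linear s1 s3 (\<lambda>x. \<beta> x y))"

definition dual_space :: "(complex \<Rightarrow> 'h::ab_group_add \<Rightarrow> 'h) \<Rightarrow> ('h \<Rightarrow> complex) set" where
  "dual_space s = {\<phi>. Vector_Spaces.linear s (*) \<phi>}"


section \<open>Lie superalgebras and their modules\<close>

definition koszul_sign :: "bit \<Rightarrow> bit \<Rightarrow> complex" where
  "koszul_sign p q = (if p = 1 \<and> q = 1 then -1 else 1)"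

locale super_vector_space = vector_space s
  for s :: "complex \<Rightarrow> 'a::ab_group_add \<Rightarrow> 'a" +
  fixes D :: "bit \<Rightarrow> 'a set"
  assumes subspace_parity: "module.subspace s (D p)"
    and parity_inter: "D 0 \<inter> D 1 = {0}"
    and parity_sum: "\<exists>y\<in>D 0. \<exists>z\<in>D 1. x = y + z"

record 'a superalg =
  smul :: "complex \<Rightarrow> 'a \<Rightarrow> 'a"
  part :: "bit \<Rightarrow> 'a set"
  brk :: "'a \<Rightarrow> 'a \<Rightarrow> 'a"

locale lie_superalgebra = super_vector_space "smul L" "part L"
  for L :: "'a::ab_group_add superalg" +
  assumes brk_bilinear: "bilinear_map (smul L) (smul L) (smul L) (brk L)"
    and brk_parity: "x \<in> part L p \<Longrightarrow> y \<in> part L q \<Longrightarrow> brk L x y \<in> part L (p + q)"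
    and super_antisym: "x \<in> part L p \<Longrightarrow> y \<in> part L q \<Longrightarrow>
          brk L x y = - smul L (koszul_sign p q) (brk L y x)"
    and super_jacobi: "x \<in> part L p \<Longrightarrow> y \<in> part L q \<Longrightarrow>
          brk L x (brk L y z) =
            brk L (brk L x y) z + smul L (koszul_sign p q) (brk L y (brk L x z))"

definition super_ideal :: "'a::ab_group_add superalg \<Rightarrow> 'a set \<Rightarrow> bool" where
  "super_ideal L J \<longleftrightarrow>
     module.subspace (smul L) J \<and>
     (\<forall>x\<in>J. \<exists>y\<in>J \<inter> part L 0. \<exists>z\<in>J \<inter> part L 1. x = y + z) \<and>
     (\<forall>x. \<forall>y\<in>J. brk L x y \<in> J)"

locale lie_superalgebra_hom = dom: lie_superalgebra L + cod: lie_superalgebra M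
  for L :: "'a::ab_group_add superalg" and M :: "'b::ab_group_add superalg" +
  fixes \<phi> :: "'a \<Rightarrow> 'b"
  assumes hom_linear: "Vector_Spaces.linear (smul L) (smul M) \<phi>"
    and hom_parity: "x \<in> part L p \<Longrightarrow> \<phi> x \<in> part M p"
    and hom_brk: "\<phi> (brk L x y) = brk M (\<phi> x) (\<phi> y)"

locale lie_supermodule = lie_superalgebra L + V: super_vector_space sv Dv
  for L :: "'a::ab_group_add superalg"
    and sv :: "complex \<Rightarrow> 'v::ab_group_add \<Rightarrow> 'v" and Dv :: "bit \<Rightarrow> 'v set" +
  fixes act :: "'a \<Rightarrow> 'v \<Rightarrow> 'v"
  assumes act_bilinear: "bilinear_map (smul L) sv sv act"
    and act_parity: "x \<in> part L p \<Longrightarrow> v \<in> Dv q \<Longrightarrow> act x v \<in> Dv (p + q)"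
    and act_brk: "x \<in> part L p \<Longrightarrow> y \<in> part L q \<Longrightarrow>
          act (brk L x y) v = act x (act y v) - sv (koszul_sign p q) (act y (act x v))"


section \<open>Contragredient Lie superalgebras\<close>

locale cartan_realization = vector_space sh
  for sh :: "complex \<Rightarrow> 'h::ab_group_add \<Rightarrow> 'h" +
  fixes A :: "complex ^ 'i ^ 'i::finite"
    and \<alpha> :: "'i \<Rightarrow> 'h \<Rightarrow> complex"
    and \<alpha>v :: "'i \<Rightarrow> 'h"
  assumes dim_h: "vector_space.dim sh UNIV = CARD('i) + (CARD('i) - rank A)"
    and simple_roots_dual: "\<alpha> i \<in> dual_space sh"
    and simple_roots_independent:
      "inj \<alpha>" "\<not> module.dependent (\<lambda>c (\<phi>::'h \<Rightarrow> complex) h. c * \<phi> h) (range \<alpha>)"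
    and simple_coroots_independent: "inj \<alpha>v" "\<not> module.dependent sh (range \<alpha>v)"
    and pairing: "\<alpha> j (\<alpha>v i) = A $ i $ j"

text \<open>
  Formal expressions in the generators. Modulo \<open>tilde_eq\<close>, the least congruence containing the
  axioms of a complex Lie superalgebra, the linear structure of \<open>h\<close> and the defining relations,
  they form \<open>g~(A,\<tau>)\<close>.
\<close>

datatype ('h, 'i) lie_term =
    GenH 'h
  | GenE 'i
  | GenF 'i
  | Zero
  | Plus "('h, 'i) lie_term" "('h, 'i) lie_term"
  | Scale complex "('h, 'i) lie_term"
  | Br "('h, 'i) lie_term" "('h, 'i) lie_term"

definition gen_parity :: "'i set \<Rightarrow> 'i \<Rightarrow> bit" where
  "gen_parity \<tau> i = (if i \<in> \<tau> then 1 else 0)"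

inductive homog :: "'i set \<Rightarrow> bit \<Rightarrow> ('h, 'i) lie_term \<Rightarrow> bool" for \<tau> where
  "homog \<tau> 0 (GenH h)"
| "homog \<tau> (gen_parity \<tau> i) (GenE i)"
| "homog \<tau> (gen_parity \<tau> i) (GenF i)"
| "homog \<tau> p Zero"
| "homog \<tau> p x \<Longrightarrow> homog \<tau> p y \<Longrightarrow> homog \<tau> p (Plus x y)"
| "homog \<tau> p x \<Longrightarrow> homog \<tau> p (Scale c x)"
| "homog \<tau> p x \<Longrightarrow> homog \<tau> q y \<Longrightarrow> homog \<tau> (p + q) (Br x y)"

inductive tilde_eq ::
  "(complex \<Rightarrow> 'h::ab_group_add \<Rightarrow> 'h) \<Rightarrow> 'i set \<Rightarrow> ('i \<Rightarrow> 'h \<Rightarrow> complex) \<Rightarrow> ('i \<Rightarrow> 'h) \<Rightarrow>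
   ('h, 'i) lie_term \<Rightarrow> ('h, 'i) lie_term \<Rightarrow> bool"
  for sh \<tau> \<alpha> \<alpha>v where
  \<comment> \<open>congruence\<close>
  "tilde_eq sh \<tau> \<alpha> \<alpha>v x x"
| "tilde_eq sh \<tau> \<alpha> \<alpha>v x y \<Longrightarrow> tilde_eq sh \<tau> \<alpha> \<alpha>v y x"
| "tilde_eq sh \<tau> \<alpha> \<alpha>v x y \<Longrightarrow> tilde_eq sh \<tau> \<alpha> \<alpha>v y z \<Longrightarrow> tilde_eq sh \<tau> \<alpha> \<alpha>v x z"
| "tilde_eq sh \<tau> \<alpha> \<alpha>v x x' \<Longrightarrow> tilde_eq sh \<tau> \<alpha> \<alpha>v y y' \<Longrightarrow>
     tilde_eq sh \<tau> \<alpha> \<alpha>v (Plus x y) (Plus x' y')"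
| "tilde_eq sh \<tau> \<alpha> \<alpha>v x x' \<Longrightarrow> tilde_eq sh \<tau> \<alpha> \<alpha>v (Scale c x) (Scale c x')"
| "tilde_eq sh \<tau> \<alpha> \<alpha>v x x' \<Longrightarrow> tilde_eq sh \<tau> \<alpha> \<alpha>v y y' \<Longrightarrow>
     tilde_eq sh \<tau> \<alpha> \<alpha>v (Br x y) (Br x' y')"
  \<comment> \<open>vector space axioms\<close>
| "tilde_eq sh \<tau> \<alpha> \<alpha>v (Plus (Plus x y) z) (Plus x (Plus y z))"
| "tilde_eq sh \<tau> \<alpha> \<alpha>v (Plus x y) (Plus y x)"
| "tilde_eq sh \<tau> \<alpha> \<alpha>v (Plus Zero x) x"
| "tilde_eq sh \<tau> \<alpha> \<alpha>v (Plus x (Scale (-1) x)) Zero"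
| "tilde_eq sh \<tau> \<alpha> \<alpha>v (Scale c (Plus x y)) (Plus (Scale c x) (Scale c y))"
| "tilde_eq sh \<tau> \<alpha> \<alpha>v (Scale (c + d) x) (Plus (Scale c x) (Scale d x))"
| "tilde_eq sh \<tau> \<alpha> \<alpha>v (Scale c (Scale d x)) (Scale (c * d) x)"
| "tilde_eq sh \<tau> \<alpha> \<alpha>v (Scale 1 x) x"
  \<comment> \<open>Lie superalgebra axioms\<close>
| "tilde_eq sh \<tau> \<alpha> \<alpha>v (Br (Plus x y) z) (Plus (Br x z) (Br y z))"
| "tilde_eq sh \<tau> \<alpha> \<alpha>v (Br x (Plus y z)) (Plus (Br x y) (Br x z))"
| "tilde_eq sh \<tau> \<alpha> \<alpha>v (Br (Scale c x) y) (Scale c (Br x y))"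
| "tilde_eq sh \<tau> \<alpha> \<alpha>v (Br x (Scale c y)) (Scale c (Br x y))"
| "homog \<tau> p x \<Longrightarrow> homog \<tau> q y \<Longrightarrow>
     tilde_eq sh \<tau> \<alpha> \<alpha>v (Br x y) (Scale (- koszul_sign p q) (Br y x))"
| "homog \<tau> p x \<Longrightarrow> homog \<tau> q y \<Longrightarrow>
     tilde_eq sh \<tau> \<alpha> \<alpha>v (Br x (Br y z))
       (Plus (Br (Br x y) z) (Scale (koszul_sign p q) (Br y (Br x z))))"
  \<comment> \<open>linear structure of the Cartan subalgebra\<close>
| "tilde_eq sh \<tau> \<alpha> \<alpha>v (GenH (h + h')) (Plus (GenH h) (GenH h'))"
| "tilde_eq sh \<tau> \<alpha> \<alpha>v (GenH (sh c h)) (Scale c (GenH h))"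
  \<comment> \<open>defining relations\<close>
| "tilde_eq sh \<tau> \<alpha> \<alpha>v (Br (GenE i) (GenF j)) (if i = j then GenH (\<alpha>v i) else Zero)"
| "tilde_eq sh \<tau> \<alpha> \<alpha>v (Br (GenH h) (GenE j)) (Scale (\<alpha> j h) (GenE j))"
| "tilde_eq sh \<tau> \<alpha> \<alpha>v (Br (GenH h) (GenF j)) (Scale (- \<alpha> j h) (GenF j))"
| "tilde_eq sh \<tau> \<alpha> \<alpha>v (Br (GenH h) (GenH h')) Zero"

fun eval_term ::
  "'a::ab_group_add superalg \<Rightarrow> ('h \<Rightarrow> 'a) \<Rightarrow> ('i \<Rightarrow> 'a) \<Rightarrow> ('i \<Rightarrow> 'a) \<Rightarrow> ('h, 'i) lie_term \<Rightarrow> 'a"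
where
  "eval_term L \<iota> e f (GenH h) = \<iota> h"
| "eval_term L \<iota> e f (GenE i) = e i"
| "eval_term L \<iota> e f (GenF i) = f i"
| "eval_term L \<iota> e f Zero = 0"
| "eval_term L \<iota> e f (Plus x y) = eval_term L \<iota> e f x + eval_term L \<iota> e f y"
| "eval_term L \<iota> e f (Scale c x) = smul L c (eval_term L \<iota> e f x)"
| "eval_term L \<iota> e f (Br x y) = brk L (eval_term L \<iota> e f x) (eval_term L \<iota> e f y)"

text \<open>\<open>Gt\<close> is \<open>g~(A,\<tau>)\<close>, with generators \<open>\<iota>t h\<close>, \<open>e i\<close>, \<open>f i\<close>.\<close>

locale tilde_superalgebra = cartan_realization sh A \<alpha> \<alpha>v + Gt: lie_superalgebra Gt
  for sh :: "complex \<Rightarrow> 'h::ab_group_add \<Rightarrow> 'h" and A :: "complex ^ 'i ^ 'i::finite"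
    and \<alpha> :: "'i \<Rightarrow> 'h \<Rightarrow> complex" and \<alpha>v :: "'i \<Rightarrow> 'h"
    and Gt :: "'t::ab_group_add superalg" +
  fixes \<tau> :: "'i set" and \<iota>t :: "'h \<Rightarrow> 't" and e f :: "'i \<Rightarrow> 't"
  assumes gen_part: "\<iota>t h \<in> part Gt 0" "e i \<in> part Gt (gen_parity \<tau> i)"
      "f i \<in> part Gt (gen_parity \<tau> i)"
    and generated: "surj (eval_term Gt \<iota>t e f)"
    and presented: "eval_term Gt \<iota>t e f x = eval_term Gt \<iota>t e f y \<longleftrightarrow> tilde_eq sh \<tau> \<alpha> \<alpha>v x y"

text \<open>
  \<open>G\<close> is \<open>g(A,\<tau>) = g~(A,\<tau>)/R\<close> with quotient map \<open>\<pi>\<close>; the map \<open>\<iota>\<close> is the canonical map of \<open>h\<close>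
  into \<open>G\<close>.
\<close>

locale contragredient_superalgebra =
  tilde_superalgebra sh A \<alpha> \<alpha>v Gt \<tau> \<iota>t e f + quot: lie_superalgebra_hom Gt G \<pi>
  for sh :: "complex \<Rightarrow> 'h::ab_group_add \<Rightarrow> 'h" and A :: "complex ^ 'i ^ 'i::finite"
    and \<alpha> :: "'i \<Rightarrow> 'h \<Rightarrow> complex" and \<alpha>v :: "'i \<Rightarrow> 'h"
    and Gt :: "'t::ab_group_add superalg"
    and \<tau> :: "'i set" and \<iota>t :: "'h \<Rightarrow> 't" and e f :: "'i \<Rightarrow> 't"
    and G :: "'g::ab_group_add superalg" and \<pi> :: "'t \<Rightarrow> 'g" +
  fixes R :: "'t set" and \<iota> :: "'h \<Rightarrow> 'g"
  assumes R_ideal: "super_ideal Gt R" "R \<inter> range \<iota>t = {0}"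
    and R_maximal: "super_ideal Gt J \<Longrightarrow> J \<inter> range \<iota>t = {0} \<Longrightarrow> J \<subseteq> R"
    and quot_surj: "surj \<pi>"
    and quot_kernel: "{x. \<pi> x = 0} = R"
    and \<iota>_eq: "\<iota> = \<pi> \<circ> \<iota>t"

definition root_space ::
  "'g::ab_group_add superalg \<Rightarrow> ('h \<Rightarrow> 'g) \<Rightarrow> ('h \<Rightarrow> complex) \<Rightarrow> 'g set" where
  "root_space G \<iota> \<beta> = {x. \<forall>h. brk G (\<iota> h) x = smul G (\<beta> h) x}"

definition roots ::
  "(complex \<Rightarrow> 'h::ab_group_add \<Rightarrow> 'h) \<Rightarrow> 'g::ab_group_add superalg \<Rightarrow> ('h \<Rightarrow> 'g) \<Rightarrow>
   ('h \<Rightarrow> complex) set" where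
  "roots sh G \<iota> = {\<beta> \<in> dual_space sh. \<beta> \<noteq> 0 \<and> root_space G \<iota> \<beta> \<noteq> {0}}"

definition simple_comb ::
  "('i::finite \<Rightarrow> 'h \<Rightarrow> complex) \<Rightarrow> ('i \<Rightarrow> nat) \<Rightarrow> 'h \<Rightarrow> complex" where
  "simple_comb \<alpha> m h = (\<Sum>i\<in>UNIV. of_nat (m i) * \<alpha> i h)"

definition pos_roots ::
  "(complex \<Rightarrow> 'h::ab_group_add \<Rightarrow> 'h) \<Rightarrow> 'g::ab_group_add superalg \<Rightarrow> ('h \<Rightarrow> 'g) \<Rightarrow>
   ('i::finite \<Rightarrow> 'h \<Rightarrow> complex) \<Rightarrow> ('h \<Rightarrow> complex) set" where
  "pos_roots sh G \<iota> \<alpha> = {\<beta> \<in> roots sh G \<iota>. \<exists>m. \<beta> = simple_comb \<alpha> m}"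

definition height :: "('i::finite \<Rightarrow> 'h \<Rightarrow> complex) \<Rightarrow> ('h \<Rightarrow> complex) \<Rightarrow> nat" where
  "height \<alpha> \<beta> = (THE n. \<exists>m. \<beta> = simple_comb \<alpha> m \<and> n = (\<Sum>i\<in>UNIV. m i))"


section \<open>The invariant form\<close>

definition symmetrizable :: "complex ^ 'i ^ 'i::finite \<Rightarrow> bool" where
  "symmetrizable A \<longleftrightarrow>
     (\<exists>D :: complex ^ 'i ^ 'i. (\<forall>i j. i \<noteq> j \<longrightarrow> D $ i $ j = 0) \<and> (\<forall>i. D $ i $ i \<noteq> 0) \<and>
        transpose (A ** D) = A ** D)"

locale invariant_form = lie_superalgebra G
  for sh :: "complex \<Rightarrow> 'h::ab_group_add \<Rightarrow> 'h"
    and G :: "'g::ab_group_add superalg" and \<iota> :: "'h \<Rightarrow> 'g" +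
  fixes form :: "'g \<Rightarrow> 'g \<Rightarrow> complex"
  assumes form_bilinear: "bilinear_map (smul G) (smul G) (*) form"
    and form_nondegenerate: "(\<And>y. form x y = 0) \<Longrightarrow> x = 0" "(\<And>x. form x y = 0) \<Longrightarrow> y = 0"
    and form_nondegenerate_h:
      "(\<And>h'. form (\<iota> h) (\<iota> h') = 0) \<Longrightarrow> h = 0" "(\<And>h. form (\<iota> h) (\<iota> h') = 0) \<Longrightarrow> h' = 0"
    and form_invariant: "form (brk G x y) z = form x (brk G y z)"
    and form_supersym: "x \<in> part G p \<Longrightarrow> y \<in> part G q \<Longrightarrow> form x y = koszul_sign p q * form y x"
    and form_orthogonal: "\<beta> \<in> dual_space sh \<Longrightarrow> \<gamma> \<in> dual_space sh \<Longrightarrow>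
      x \<in> root_space G \<iota> \<beta> \<Longrightarrow> y \<in> root_space G \<iota> \<gamma> \<Longrightarrow> form x y \<noteq> 0 \<Longrightarrow> \<beta> + \<gamma> = 0"
    and form_pairing:
      "\<beta> \<in> roots sh G \<iota> \<Longrightarrow> x \<in> root_space G \<iota> \<beta> \<Longrightarrow>
         (\<And>y. y \<in> root_space G \<iota> (- \<beta>) \<Longrightarrow> form x y = 0) \<Longrightarrow> x = 0"
      "\<beta> \<in> roots sh G \<iota> \<Longrightarrow> y \<in> root_space G \<iota> (- \<beta>) \<Longrightarrow>
         (\<And>x. x \<in> root_space G \<iota> \<beta> \<Longrightarrow> form x y = 0) \<Longrightarrow> y = 0"
    and form_even: "x \<in> part G 0 \<Longrightarrow> y \<in> part G 1 \<Longrightarrow> form x y = 0"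
      "x \<in> part G 1 \<Longrightarrow> y \<in> part G 0 \<Longrightarrow> form x y = 0"

definition h_of :: "('h \<Rightarrow> 'g) \<Rightarrow> ('g \<Rightarrow> 'g \<Rightarrow> complex) \<Rightarrow> ('h \<Rightarrow> complex) \<Rightarrow> 'h" where
  "h_of \<iota> form \<beta> = (THE k. \<forall>h. form (\<iota> k) (\<iota> h) = \<beta> h)"

definition dual_form ::
  "('h \<Rightarrow> 'g) \<Rightarrow> ('g \<Rightarrow> 'g \<Rightarrow> complex) \<Rightarrow> ('h \<Rightarrow> complex) \<Rightarrow> ('h \<Rightarrow> complex) \<Rightarrow> complex" where
  "dual_form \<iota> form \<beta> \<gamma> = form (\<iota> (h_of \<iota> form \<beta>)) (\<iota> (h_of \<iota> form \<gamma>))"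

definition is_rho ::
  "(complex \<Rightarrow> 'h::ab_group_add \<Rightarrow> 'h) \<Rightarrow> ('i \<Rightarrow> 'h \<Rightarrow> complex) \<Rightarrow> ('h \<Rightarrow> 'g) \<Rightarrow>
   ('g \<Rightarrow> 'g \<Rightarrow> complex) \<Rightarrow> ('h \<Rightarrow> complex) \<Rightarrow> bool" where
  "is_rho sh \<alpha> \<iota> form \<rho> \<longleftrightarrow>
     \<rho> \<in> dual_space sh \<and> (\<forall>i. 2 * dual_form \<iota> form \<rho> (\<alpha> i) = dual_form \<iota> form (\<alpha> i) (\<alpha> i))"

definition mult :: "'g::ab_group_add superalg \<Rightarrow> ('h \<Rightarrow> 'g) \<Rightarrow> ('h \<Rightarrow> complex) \<Rightarrow> nat" where
  "mult G \<iota> \<beta> = vector_space.dim (smul G) (root_space G \<iota> \<beta>)"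

definition dual_bases_h ::
  "(complex \<Rightarrow> 'h::ab_group_add \<Rightarrow> 'h) \<Rightarrow> ('h \<Rightarrow> 'g) \<Rightarrow> ('g \<Rightarrow> 'g \<Rightarrow> complex) \<Rightarrow>
   (nat \<Rightarrow> 'h) \<Rightarrow> (nat \<Rightarrow> 'h) \<Rightarrow> bool" where
  "dual_bases_h sh \<iota> form hb hc \<longleftrightarrow>
     (let n = vector_space.dim sh UNIV in
        is_basis sh n hb UNIV \<and> is_basis sh n hc UNIV \<and>
        (\<forall>i<n. \<forall>j<n. form (\<iota> (hb i)) (\<iota> (hc j)) = (if i = j then 1 else 0)))"

definition dual_bases_roots ::
  "(complex \<Rightarrow> 'h::ab_group_add \<Rightarrow> 'h) \<Rightarrow> 'g::ab_group_add superalg \<Rightarrow> ('h \<Rightarrow> 'g) \<Rightarrow>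
   ('i::finite \<Rightarrow> 'h \<Rightarrow> complex) \<Rightarrow> ('g \<Rightarrow> 'g \<Rightarrow> complex) \<Rightarrow>
   (('h \<Rightarrow> complex) \<Rightarrow> nat \<Rightarrow> 'g) \<Rightarrow> (('h \<Rightarrow> complex) \<Rightarrow> nat \<Rightarrow> 'g) \<Rightarrow> bool" where
  "dual_bases_roots sh G \<iota> \<alpha> form eb fb \<longleftrightarrow>
     (\<forall>\<beta>\<in>pos_roots sh G \<iota> \<alpha>.
        is_basis (smul G) (mult G \<iota> \<beta>) (eb \<beta>) (root_space G \<iota> \<beta>) \<and>
        is_basis (smul G) (mult G \<iota> \<beta>) (fb \<beta>) (root_space G \<iota> (- \<beta>)) \<and>
        (\<forall>i<mult G \<iota> \<beta>. \<forall>j<mult G \<iota> \<beta>. form (eb \<beta> i) (fb \<beta> j) = (if i = j then 1 else 0)))"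


section \<open>Loop algebras and category O\<close>

definition subalgebra :: "(complex \<Rightarrow> 'b::comm_ring_1 \<Rightarrow> 'b) \<Rightarrow> 'b set \<Rightarrow> bool" where
  "subalgebra sb S \<longleftrightarrow> module.subspace sb S \<and> 1 \<in> S \<and> (\<forall>x\<in>S. \<forall>y\<in>S. x * y \<in> S)"

locale fg_comm_algebra = vector_space sb
  for sb :: "complex \<Rightarrow> 'b::comm_ring_1 \<Rightarrow> 'b" +
  assumes sb_mult: "sb c (x * y) = sb c x * y"
    and finitely_generated: "\<exists>S. finite S \<and> subalgebra sb hull S = UNIV"

text \<open>
  \<open>t\<close> exhibits the target as the quotient of the free vector space on all pairs by the span of
  the bilinearity relators.
\<close>

definition tensor_relators ::
  "(complex \<Rightarrow> 'a::ab_group_add \<Rightarrow> 'a) \<Rightarrow> (complex \<Rightarrow> 'b::ab_group_add \<Rightarrow> 'b) \<Rightarrow>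
   (('a \<times> 'b) \<Rightarrow>\<^sub>0 complex) set" where
  "tensor_relators s1 s2 =
     {Poly_Mapping.single (x + x', y) 1 - Poly_Mapping.single (x, y) 1
        - Poly_Mapping.single (x', y) 1 | x x' y. True} \<union>
     {Poly_Mapping.single (x, y + y') 1 - Poly_Mapping.single (x, y) 1
        - Poly_Mapping.single (x, y') 1 | x y y'. True} \<union>
     {Poly_Mapping.single (s1 c x, y) 1 - Poly_Mapping.single (x, y) c | c x y. True} \<union>
     {Poly_Mapping.single (x, s2 c y) 1 - Poly_Mapping.single (x, y) c | c x y. True}"

definition tensor_eval ::
  "(complex \<Rightarrow> 'c::ab_group_add \<Rightarrow> 'c) \<Rightarrow> ('a \<Rightarrow> 'b \<Rightarrow> 'c) \<Rightarrow> (('a \<times> 'b) \<Rightarrow>\<^sub>0 complex) \<Rightarrow> 'c" where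
  "tensor_eval s t u =
     (\<Sum>k\<in>Poly_Mapping.keys u. s (Poly_Mapping.lookup u k) (t (fst k) (snd k)))"

definition is_tensor_product ::
  "(complex \<Rightarrow> 'a::ab_group_add \<Rightarrow> 'a) \<Rightarrow> (complex \<Rightarrow> 'b::ab_group_add \<Rightarrow> 'b) \<Rightarrow>
   (complex \<Rightarrow> 'c::ab_group_add \<Rightarrow> 'c) \<Rightarrow> ('a \<Rightarrow> 'b \<Rightarrow> 'c) \<Rightarrow> bool" where
  "is_tensor_product s1 s2 s3 t \<longleftrightarrow>
     surj (tensor_eval s3 t) \<and>
     {u. tensor_eval s3 t u = 0} =
       module.span (\<lambda>c. Poly_Mapping.map ((*) c)) (tensor_relators s1 s2)"

locale loop_superalgebra = G: lie_superalgebra G + B: fg_comm_algebra sb + GB: lie_superalgebra GB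
  for G :: "'g::ab_group_add superalg" and sb :: "complex \<Rightarrow> 'b::comm_ring_1 \<Rightarrow> 'b"
    and GB :: "'gb::ab_group_add superalg" +
  fixes t :: "'g \<Rightarrow> 'b \<Rightarrow> 'gb"
  assumes tensor: "is_tensor_product (smul G) sb (smul GB) t"
    and part_tensor: "part GB p = module.span (smul GB) {t x a | x a. x \<in> part G p}"
    and brk_tensor: "brk GB (t x a) (t y b) = t (brk G x y) (a * b)"

definition weight_space ::
  "('h \<Rightarrow> 'g) \<Rightarrow> ('g \<Rightarrow> 'b::comm_ring_1 \<Rightarrow> 'gb) \<Rightarrow> (complex \<Rightarrow> 'v \<Rightarrow> 'v) \<Rightarrow>
   ('gb \<Rightarrow> 'v \<Rightarrow> 'v) \<Rightarrow> ('h \<Rightarrow> complex) \<Rightarrow> 'v set" where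
  "weight_space \<iota> t sv act \<mu> = {v. \<forall>h. act (t (\<iota> h) 1) v = sv (\<mu> h) v}"

locale category_O_module = lie_supermodule GB sv Dv act
  for sh :: "complex \<Rightarrow> 'h::ab_group_add \<Rightarrow> 'h" and G :: "'g::ab_group_add superalg"
    and \<iota> :: "'h \<Rightarrow> 'g" and \<alpha> :: "'i::finite \<Rightarrow> 'h \<Rightarrow> complex"
    and GB :: "'gb::ab_group_add superalg" and t :: "'g \<Rightarrow> 'b::comm_ring_1 \<Rightarrow> 'gb"
    and sv :: "complex \<Rightarrow> 'v::ab_group_add \<Rightarrow> 'v" and Dv :: "bit \<Rightarrow> 'v set"
    and act :: "'gb \<Rightarrow> 'v \<Rightarrow> 'v" +
  assumes weight_decomposition: "is_direct_sum sv (dual_space sh) (weight_space \<iota> t sv act)"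
    and weight_space_finite: "\<mu> \<in> dual_space sh \<Longrightarrow>
      \<exists>S. finite S \<and> module.span sv S = weight_space \<iota> t sv act \<mu>"
    and locally_nilpotent: "\<exists>N. \<forall>\<beta>\<in>pos_roots sh G \<iota> \<alpha>. height \<alpha> \<beta> \<ge> N \<longrightarrow>
      (\<forall>x\<in>root_space G \<iota> \<beta>. act (t x a) v = 0)"


section \<open>The Casimir operator\<close>

definition Omega_root ::
  "'g::ab_group_add superalg \<Rightarrow> ('h \<Rightarrow> 'g) \<Rightarrow> (('h \<Rightarrow> complex) \<Rightarrow> nat \<Rightarrow> 'g) \<Rightarrow>
   (('h \<Rightarrow> complex) \<Rightarrow> nat \<Rightarrow> 'g) \<Rightarrow> ('g \<Rightarrow> 'b \<Rightarrow> 'gb) \<Rightarrow> ('gb \<Rightarrow> 'v::ab_group_add \<Rightarrow> 'v) \<Rightarrow>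
   ('h \<Rightarrow> complex) \<Rightarrow> 'b \<Rightarrow> 'b \<Rightarrow> 'v \<Rightarrow> 'v" where
  "Omega_root G \<iota> eb fb t act \<beta> a b v =
     (\<Sum>i<mult G \<iota> \<beta>. act (t (fb \<beta> i) a) (act (t (eb \<beta> i) b) v))"

text \<open>
  On a module in category O only finitely many positive roots contribute to \<open>Omega a b v\<close>;
  the sums are taken over these roots.
\<close>

definition Omega ::
  "(complex \<Rightarrow> 'h::ab_group_add \<Rightarrow> 'h) \<Rightarrow> 'g::ab_group_add superalg \<Rightarrow> ('h \<Rightarrow> 'g) \<Rightarrow>
   ('i::finite \<Rightarrow> 'h \<Rightarrow> complex) \<Rightarrow> ('g \<Rightarrow> 'g \<Rightarrow> complex) \<Rightarrow> ('h \<Rightarrow> complex) \<Rightarrow>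
   (nat \<Rightarrow> 'h) \<Rightarrow> (nat \<Rightarrow> 'h) \<Rightarrow>
   (('h \<Rightarrow> complex) \<Rightarrow> nat \<Rightarrow> 'g) \<Rightarrow> (('h \<Rightarrow> complex) \<Rightarrow> nat \<Rightarrow> 'g) \<Rightarrow>
   ('g \<Rightarrow> 'b::comm_ring_1 \<Rightarrow> 'gb) \<Rightarrow> (complex \<Rightarrow> 'v::ab_group_add \<Rightarrow> 'v) \<Rightarrow>
   ('gb \<Rightarrow> 'v \<Rightarrow> 'v) \<Rightarrow> 'b \<Rightarrow> 'b \<Rightarrow> 'v \<Rightarrow> 'v" where
  "Omega sh G \<iota> \<alpha> form \<rho> hb hc eb fb t sv act a b v =
     sv 2 (act (t (\<iota> (h_of \<iota> form \<rho>)) (a * b)) v)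
     + (\<Sum>i<vector_space.dim sh UNIV. act (t (\<iota> (hb i)) a) (act (t (\<iota> (hc i)) b) v))
     + (\<Sum>\<beta> | \<beta> \<in> pos_roots sh G \<iota> \<alpha> \<and> Omega_root G \<iota> eb fb t act \<beta> a b v \<noteq> 0.
          Omega_root G \<iota> eb fb t act \<beta> a b v)
     + (\<Sum>\<beta> | \<beta> \<in> pos_roots sh G \<iota> \<alpha> \<and> Omega_root G \<iota> eb fb t act \<beta> b a v \<noteq> 0.
          Omega_root G \<iota> eb fb t act \<beta> b a v)"

end

theory Submission
  imports Defs
begin

text \<open>
  It suffices to commute \<open>\<Omega>(a,b)\<close> with \<open>h\<close>, \<open>e\<^sub>j\<close> and \<open>f\<^sub>j\<close>. Let \<open>x\<close> be a homogeneous vector of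
  weight \<open>\<xi> = \<plusminus>\<alpha>\<^sub>j\<close>. The commutator of \<open>x\<close> with \<open>\<Sum>\<^sub>i f\<^sub>\<beta>\<^sup>i(a) e\<^sub>\<beta>\<^sup>i(b)\<close> is the sum of an upper term, in
  which \<open>x\<close> hits \<open>e\<^sub>\<beta>\<^sup>i\<close>, and a lower term, in which it hits \<open>f\<^sub>\<beta>\<^sup>i\<close>. By invariance of the form, the
  upper term at \<open>\<beta>\<close> cancels the lower term at \<open>\<beta> + \<xi>\<close> as long as both are positive roots. What
  survives is the boundary term where \<open>\<beta>\<close> or \<open>\<beta> + \<xi>\<close> is \<open>0\<close>; there \<open>[x, y] = (x, y) h\<^sub>\<xi>\<close>, which rests
  on the triangular decomposition (the root space of weight \<open>0\<close> is \<open>h\<close>). The boundary terms are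
  compensated by the commutator of \<open>x\<close> with \<open>\<Sum>\<^sub>i h\<^sub>i(a) h\<^sup>i(b)\<close>, up to \<open>(\<alpha>\<^sub>j, \<alpha>\<^sub>j) x(ab)\<close>, which the
  choice of \<open>\<rho>\<close> removes.
\<close>

section \<open>Weight vectors in Lie superalgebras\<close>

lemma bilinear_mapD:
  assumes "bilinear_map s1 s2 s3 \<beta>"
  shows "\<beta> (x + x') y = \<beta> x y + \<beta> x' y" "\<beta> x (y + y') = \<beta> x y + \<beta> x y'"
    and "\<beta> (s1 c x) y = s3 c (\<beta> x y)" "\<beta> x (s2 c y) = s3 c (\<beta> x y)"
    and "\<beta> 0 y = 0" "\<beta> x 0 = 0"
    and "\<beta> (- x) y = - \<beta> x y" "\<beta> x (- y) = - \<beta> x y"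
    and "\<beta> (x - x') y = \<beta> x y - \<beta> x' y" "\<beta> x (y - y') = \<beta> x y - \<beta> x y'"
    and "\<beta> (sum u K) y = (\<Sum>k\<in>K. \<beta> (u k) y)" "\<beta> x (sum w K) = (\<Sum>k\<in>K. \<beta> x (w k))"
proof -
  interpret l: Vector_Spaces.linear s1 s3 "\<lambda>x. \<beta> x y" for y
    using assms by (simp add: bilinear_map_def)
  interpret r: Vector_Spaces.linear s2 s3 "\<beta> x" for x
    using assms by (simp add: bilinear_map_def)
  show "\<beta> (x + x') y = \<beta> x y + \<beta> x' y" "\<beta> x (y + y') = \<beta> x y + \<beta> x y'"
    and "\<beta> (s1 c x) y = s3 c (\<beta> x y)" "\<beta> x (s2 c y) = s3 c (\<beta> x y)"
    and "\<beta> 0 y = 0" "\<beta> x 0 = 0"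
    and "\<beta> (- x) y = - \<beta> x y" "\<beta> x (- y) = - \<beta> x y"
    and "\<beta> (x - x') y = \<beta> x y - \<beta> x' y" "\<beta> x (y - y') = \<beta> x y - \<beta> x y'"
    and "\<beta> (sum u K) y = (\<Sum>k\<in>K. \<beta> (u k) y)" "\<beta> x (sum w K) = (\<Sum>k\<in>K. \<beta> x (w k))"
    by (simp_all add: l.add r.add l.scale r.scale l.zero r.zero l.neg r.neg l.diff r.diff
        l.sum r.sum)
qed

lemma koszul_sign_simps [simp]:
  "koszul_sign 0 q = 1" "koszul_sign p 0 = 1" "koszul_sign p q * koszul_sign p q = 1"
  "koszul_sign p q * (koszul_sign p q * c) = c"
  by (simp_all add: koszul_sign_def)

lemma module_fun: "module (\<lambda>c (\<phi> :: 'h \<Rightarrow> complex) h. c * \<phi> h)"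
  by unfold_locales (auto simp: fun_eq_iff algebra_simps)

lemma finite_nat_funs_bounded: "finite {m :: 'i::finite \<Rightarrow> nat. (\<Sum>i\<in>UNIV. m i) < N}"
proof (rule finite_subset)
  show "{m :: 'i \<Rightarrow> nat. (\<Sum>i\<in>UNIV. m i) < N} \<subseteq> PiE UNIV (\<lambda>_. {..<N})"
  proof
    fix m :: "'i \<Rightarrow> nat" assume "m \<in> {m. (\<Sum>i\<in>UNIV. m i) < N}"
    moreover have "m i \<le> (\<Sum>i\<in>UNIV. m i)" for i by (rule member_le_sum) auto
    ultimately have "m i < N" for i using order.strict_trans1[of "m i"] by blast
    then show "m \<in> PiE UNIV (\<lambda>_. {..<N})" by auto
  qed
  show "finite (PiE (UNIV :: 'i set) (\<lambda>_. {..<N}))" by (rule finite_PiE) auto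
qed

text \<open>Stated over a semiring because it is used twice: over the complex numbers for weights
  and over \<open>bit\<close> for parities.\<close>

lemma sum_of_nat_Suc:
  fixes m :: "'i::finite \<Rightarrow> nat" and f :: "'i \<Rightarrow> 'a::comm_semiring_1"
  shows "(\<Sum>i\<in>UNIV. of_nat ((m(j := Suc (m j))) i) * f i) = f j + (\<Sum>i\<in>UNIV. of_nat (m i) * f i)"
proof -
  have "(\<Sum>i\<in>UNIV. of_nat ((m(j := Suc (m j))) i) * f i)
      = (\<Sum>i\<in>UNIV. (if i = j then f i else 0) + of_nat (m i) * f i)"
    by (rule sum.cong) (auto simp: algebra_simps)
  then show ?thesis by (simp add: sum.distrib)
qed

lemma simple_comb_0 [simp]: "simple_comb \<alpha> (\<lambda>_. 0) = 0"
  by (auto simp: simple_comb_def fun_eq_iff)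

lemma simple_comb_Suc: "simple_comb \<alpha> (m(j := Suc (m j))) = \<alpha> j + simple_comb \<alpha> m"
  by (rule ext, unfold simple_comb_def plus_fun_apply, rule sum_of_nat_Suc)

lemma simple_comb_single: "simple_comb \<alpha> ((\<lambda>_. 0)(j := Suc 0)) = \<alpha> j"
  using simple_comb_Suc[of \<alpha> "\<lambda>_. 0" j] by simp

lemma simple_comb_uminus: "simple_comb (\<lambda>i. - \<alpha> i) m = - simple_comb \<alpha> m"
  by (auto simp: simple_comb_def fun_eq_iff sum_negf)

lemma dual_space_iff:
  assumes "vector_space s"
  shows "\<phi> \<in> dual_space s \<longleftrightarrow> (\<forall>x y. \<phi> (x + y) = \<phi> x + \<phi> y) \<and> (\<forall>c x. \<phi> (s c x) = c * \<phi> x)"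
proof -
  interpret vector_space s by fact
  have "vector_space ((*) :: complex \<Rightarrow> complex \<Rightarrow> complex)"
    by unfold_locales (auto simp: algebra_simps)
  then show ?thesis
    using vector_space_axioms
    by (auto simp: dual_space_def Vector_Spaces.linear_iff)
qed

text \<open>The parity of a bracket monomial containing the i-th generator \<open>m i\<close> times;
  \<open>of_nat\<close> into \<open>bit\<close> reduces \<open>m i\<close> modulo 2.\<close>

definition comb_parity :: "('i::finite \<Rightarrow> bit) \<Rightarrow> ('i \<Rightarrow> nat) \<Rightarrow> bit" where
  "comb_parity p m = (\<Sum>i\<in>UNIV. of_nat (m i) * p i)"

lemma comb_parity_0 [simp]: "comb_parity p (\<lambda>_. 0) = 0"
  by (simp add: comb_parity_def)

lemma comb_parity_Suc: "comb_parity p (m(j := Suc (m j))) = p j + comb_parity p m"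
  unfolding comb_parity_def by (rule sum_of_nat_Suc)

lemma comb_parity_single: "comb_parity p ((\<lambda>_. 0)(j := Suc 0)) = p j"
  using comb_parity_Suc[of p "\<lambda>_. 0" j] by simp

text \<open>Right-normed bracket monomials in one family of generators. The index \<open>m\<close>
  counts the occurrences of each generator, so that weight and parity can both be read off from
  it.\<close>

inductive iter_brk ::
  "'a::ab_group_add superalg \<Rightarrow> ('i \<Rightarrow> 'a) \<Rightarrow> ('i \<Rightarrow> nat) \<Rightarrow> 'a \<Rightarrow> bool" for L E where
  single: "iter_brk L E ((\<lambda>_. 0)(i := Suc 0)) (E i)"
| step: "iter_brk L E m x \<Longrightarrow> iter_brk L E (m(i := Suc (m i))) (brk L (E i) x)"

lemma iter_brk_nonzero: "iter_brk L E m x \<Longrightarrow> m \<noteq> (\<lambda>_. 0)"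
  by (induction rule: iter_brk.induct) (auto simp: fun_eq_iff)

section \<open>Weight vectors and bracket monomials\<close>

context lie_superalgebra
begin

lemmas brk_simps = bilinear_mapD[OF brk_bilinear]

lemma parity_cases:
  obtains y z where "y \<in> part L 0" "z \<in> part L 1" "x = y + z"
  using parity_sum by blast

lemma part_0 [simp]: "0 \<in> part L p"
  using subspace_parity subspace_0 by blast

lemma part_scale: "x \<in> part L p \<Longrightarrow> smul L c x \<in> part L p"
  using subspace_parity subspace_scale by blast

lemma part_add: "x \<in> part L p \<Longrightarrow> y \<in> part L p \<Longrightarrow> x + y \<in> part L p"
  using subspace_parity subspace_add by blast

text \<open>Against an even element every Koszul sign is 1, so the axiom for homogeneous elements
  extends additively to all \<open>y\<close>. The Jacobi identity below is extended in the same
  way.\<close>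

lemma brk_even_antisym: "x \<in> part L 0 \<Longrightarrow> brk L y x = - brk L x y"
  by (rule parity_cases[of y]) (simp add: brk_simps super_antisym[of x 0])

lemma jacobi_even:
  "x \<in> part L 0 \<Longrightarrow> brk L x (brk L y z) = brk L (brk L x y) z + brk L y (brk L x z)"
  by (rule parity_cases[of y]) (simp add: brk_simps super_jacobi[of x 0])

lemma subspace_root_space: "subspace (root_space L \<iota> \<beta>)"
  by (auto simp: subspace_def root_space_def brk_simps algebra_simps)

lemma root_space_0 [simp]: "0 \<in> root_space L \<iota> \<beta>"
  by (simp add: root_space_def brk_simps)

lemma brk_root_space:
  assumes "\<And>h. \<iota> h \<in> part L 0" "x \<in> root_space L \<iota> \<beta>" "y \<in> root_space L \<iota> \<gamma>"
  shows "brk L x y \<in> root_space L \<iota> (\<beta> + \<gamma>)"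
  using assms by (auto simp: root_space_def jacobi_even brk_simps scale_left_distrib)

text \<open>Choose h with \<gamma> h different from \<delta> h. Applying [\<iota> h, -] - \<delta> h
  to the relation removes the summand at \<delta> and multiplies the one at \<gamma> by a nonzero
  scalar, which leaves a relation with one weight fewer.\<close>

lemma root_vectors_independent:
  assumes "finite K" "\<And>\<gamma>. \<gamma> \<in> K \<Longrightarrow> u \<gamma> \<in> root_space L \<iota> \<gamma>" "(\<Sum>\<gamma>\<in>K. u \<gamma>) = 0" "\<gamma> \<in> K"
  shows "u \<gamma> = 0"
  using assms
proof (induction K arbitrary: u \<gamma> rule: finite_induct)
  case empty
  then show ?case by simp
next
  case (insert \<delta> K)
  have sum0: "u \<delta> + (\<Sum>\<gamma>\<in>K. u \<gamma>) = 0" using insert by simp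
  have *: "u \<gamma> = 0" if "\<gamma> \<in> K" for \<gamma>
  proof -
    have "\<gamma> \<noteq> \<delta>" using that insert by auto
    then obtain h where h: "\<gamma> h \<noteq> \<delta> h" by (auto simp: fun_eq_iff)
    have "(\<Sum>\<gamma>\<in>K. smul L (\<gamma> h - \<delta> h) (u \<gamma>))
        = (\<Sum>\<gamma>\<in>K. brk L (\<iota> h) (u \<gamma>)) - smul L (\<delta> h) (\<Sum>\<gamma>\<in>K. u \<gamma>)"
      using insert.prems(1)
      by (auto simp: scale_left_diff_distrib sum_subtractf scale_sum_right root_space_def
          intro!: sum.cong)
    also have "\<dots> = brk L (\<iota> h) (- u \<delta>) - smul L (\<delta> h) (- u \<delta>)"
      by (simp only: brk_simps(12)[symmetric] minus_unique[OF sum0, symmetric]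
          minus_minus)
    also have "\<dots> = 0"
      using insert.prems(1)[of \<delta>] by (simp add: brk_simps root_space_def)
    finally have "(\<Sum>\<gamma>\<in>K. smul L (\<gamma> h - \<delta> h) (u \<gamma>)) = 0" .
    then have "smul L (\<gamma> h - \<delta> h) (u \<gamma>) = 0"
      using that insert.prems(1)
      by (intro insert.IH[of "\<lambda>\<gamma>. smul L (\<gamma> h - \<delta> h) (u \<gamma>)"])
        (simp_all add: subspace_scale[OF subspace_root_space])
    with h show ?thesis by simp
  qed
  then have "u \<delta> = 0" using sum0 by simp
  with * insert.prems show ?case by auto
qed

text \<open>Write x as a finite sum of vectors from the \<open>S \<gamma>\<close>. Since x has the
  single weight \<beta>, independence of weights forces the summand at \<beta> to be x.\<close>

lemma root_component:
  assumes span: "span (\<Union>\<gamma>. S \<gamma>) = UNIV"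
    and sub: "\<And>\<gamma>. subspace (S \<gamma>)" and root: "\<And>\<gamma>. S \<gamma> \<subseteq> root_space L \<iota> \<gamma>"
    and x: "x \<in> root_space L \<iota> \<beta>"
  shows "x \<in> S \<beta>"
proof -
  have "\<exists>K u. finite K \<and> (\<forall>\<gamma>. u \<gamma> \<in> S \<gamma>) \<and> (\<forall>\<gamma>. \<gamma> \<notin> K \<longrightarrow> u \<gamma> = 0) \<and> y = (\<Sum>\<gamma>\<in>K. u \<gamma>)"
    if "y \<in> span (\<Union>\<gamma>. S \<gamma>)" for y
    using that
  proof (induction rule: span_induct_alt)
    case base
    then show ?case
      using sub subspace_0 by (intro exI[of _ "{}"] exI[of _ "\<lambda>_. 0"]) auto
  next
    case (step c z y)
    then obtain K u \<delta> where K: "finite K" "\<forall>\<gamma>. u \<gamma> \<in> S \<gamma>" "\<forall>\<gamma>. \<gamma> \<notin> K \<longrightarrow> u \<gamma> = 0"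
      "y = (\<Sum>\<gamma>\<in>K. u \<gamma>)" and z: "z \<in> S \<delta>" by auto
    let ?u = "\<lambda>\<gamma>. (if \<gamma> = \<delta> then smul L c z else 0) + u \<gamma>"
    have "(\<Sum>\<gamma>\<in>insert \<delta> K. u \<gamma>) = y"
      using K by (auto simp: sum.insert_if)
    then have "smul L c z + y = (\<Sum>\<gamma>\<in>insert \<delta> K. ?u \<gamma>)"
      using K by (simp add: sum.distrib del: sum.insert)
    moreover have "?u \<gamma> \<in> S \<gamma>" for \<gamma>
      using K z sub by (auto intro!: subspace_add subspace_scale)
    ultimately show ?case
      using K by (intro exI[of _ "insert \<delta> K"] exI[of _ ?u]) auto
  qed
  then obtain K u where K: "finite K" "\<And>\<gamma>. u \<gamma> \<in> S \<gamma>" "\<And>\<gamma>. \<gamma> \<notin> K \<Longrightarrow> u \<gamma> = 0"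
    "x = (\<Sum>\<gamma>\<in>K. u \<gamma>)" using span by (metis UNIV_I)
  \<comment> \<open>The decomposition minus x placed at weight \<beta>: a family of weight vectors
    with vanishing sum.\<close>
  let ?w = "\<lambda>\<gamma>. u \<gamma> - (if \<gamma> = \<beta> then x else 0)"
  have "(\<Sum>\<gamma>\<in>insert \<beta> K. u \<gamma>) = x"
    using K by (auto simp: sum.insert_if)
  then have "(\<Sum>\<gamma>\<in>insert \<beta> K. ?w \<gamma>) = 0"
    using K by (simp add: sum_subtractf del: sum.insert)
  moreover have "?w \<gamma> \<in> root_space L \<iota> \<gamma>" for \<gamma>
    using K(2)[of \<gamma>] root x by (auto intro!: subspace_diff[OF subspace_root_space])
  ultimately have "?w \<beta> = 0"
    using K(1) by (intro root_vectors_independent[of "insert \<beta> K" ?w \<iota> \<beta>]) simp_all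
  then show ?thesis using K(2)[of \<beta>] by simp
qed

lemma iter_brk_weight:
  assumes "\<And>h. \<iota> h \<in> part L 0" "\<And>i. E i \<in> root_space L \<iota> (a i)" "iter_brk L E m x"
  shows "x \<in> root_space L \<iota> (simple_comb a m)"
  using assms(3)
proof induction
  case (single i)
  show ?case by (subst simple_comb_single) (rule assms(2))
next
  case (step m x i)
  then show ?case by (subst simple_comb_Suc) (rule brk_root_space[OF assms(1,2)])
qed

lemma iter_brk_parity:
  assumes "\<And>i. E i \<in> part L (p i)" "iter_brk L E m x"
  shows "x \<in> part L (comb_parity p m)"
  using assms(2)
proof induction
  case (single i)
  show ?case by (subst comb_parity_single) (rule assms(1))
next
  case (step m x i)
  then show ?case by (subst comb_parity_Suc) (rule brk_parity[OF assms(1)])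
qed

lemma span_brk:
  assumes "\<And>y. y \<in> S \<Longrightarrow> brk L x y \<in> span T" "y \<in> span S"
  shows "brk L x y \<in> span T"
  using assms(2)
  by (induction rule: span_induct_alt)
    (auto simp: brk_simps span_zero intro!: span_add span_scale assms(1))

text \<open>By Jacobi, [F i, [E j, x]] is [[F i, E j], x], a Cartan element acting on x by a scalar,
  plus a multiple of [E j, [F i, x]], which the induction hypothesis covers. The generators are
  abstract so that the two halves can be exchanged.\<close>

lemma brk_iter_brk_opposite:
  fixes E F :: "'i::finite \<Rightarrow> 'a"
  assumes \<iota>: "\<And>h. \<iota> h \<in> part L 0"
    and E: "\<And>i. E i \<in> root_space L \<iota> (a i)"
    and par: "\<And>i. E i \<in> part L (p i)" "\<And>i. F i \<in> part L (p i)"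
    and FE: "\<And>i j. brk L (F i) (E j) \<in> range \<iota>"
    and "iter_brk L E m x"
  shows "brk L (F i) x \<in> span ({x. \<exists>m. iter_brk L E m x} \<union> range \<iota>)" (is "_ \<in> span ?U")
  using assms(6)
proof induction
  case (single j)
  then show ?case using FE by (auto intro: span_base)
next
  case (step m x j)
  have 1: "brk L (\<iota> h) x \<in> span ?U" for h
  proof -
    have "brk L (\<iota> h) x = smul L (simple_comb a m h) x"
      using iter_brk_weight[OF \<iota> E step.hyps] unfolding root_space_def by blast
    moreover have "x \<in> span ?U" using step.hyps by (intro span_base) blast
    ultimately show ?thesis by (simp add: span_scale)
  qed
  \<comment> \<open>The only new case is [E j, \<iota> h], a multiple of the monomial
    \<open>E j\<close>.\<close>
  have 2: "brk L (E j) y \<in> span ?U" if "y \<in> span ?U" for y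
    using that
  proof (rule span_brk[rotated])
    fix y assume "y \<in> ?U"
    then consider m where "iter_brk L E m y" | h where "y = \<iota> h" by auto
    then show "brk L (E j) y \<in> span ?U"
    proof cases
      case 1
      then show ?thesis by (auto intro: span_base iter_brk.step)
    next
      case 2
      have "brk L (E j) y = - smul L (a j h) (E j)"
        using E[of j] unfolding 2 brk_even_antisym[OF \<iota>] root_space_def by simp
      moreover have "E j \<in> span ?U" using iter_brk.single[of L E j] by (intro span_base) blast
      ultimately show ?thesis by (simp add: span_scale span_neg)
    qed
  qed
  have "brk L (F i) (brk L (E j) x) = brk L (brk L (F i) (E j)) x
      + smul L (koszul_sign (p i) (p j)) (brk L (E j) (brk L (F i) x))"
    by (intro super_jacobi par)
  moreover obtain h where "brk L (F i) (E j) = \<iota> h" using FE by blast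
  ultimately show ?case using 1[of h] 2[OF step.IH] by (simp add: span_add span_scale)
qed

end

section \<open>The contragredient Lie superalgebra\<close>

locale contragredient_form =
  h: vector_space sh + g: lie_superalgebra G +
  contra: contragredient_superalgebra sh A \<alpha> \<alpha>v Gt \<tau> \<iota>t e f G \<pi> R \<iota> +
  inv: invariant_form sh G \<iota> form
  for sh :: "complex \<Rightarrow> 'h::ab_group_add \<Rightarrow> 'h"
    and A :: "complex ^ 'i ^ 'i::finite"
    and \<alpha> :: "'i \<Rightarrow> 'h \<Rightarrow> complex" and \<alpha>v :: "'i \<Rightarrow> 'h"
    and Gt :: "'t::ab_group_add superalg" and \<tau> :: "'i set"
    and \<iota>t :: "'h \<Rightarrow> 't" and e f :: "'i \<Rightarrow> 't"
    and G :: "'g::ab_group_add superalg" and \<pi> :: "'t \<Rightarrow> 'g" and R :: "'t set"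
    and \<iota> :: "'h \<Rightarrow> 'g" and form :: "'g \<Rightarrow> 'g \<Rightarrow> complex"
begin

section \<open>Generators and relations in the quotient\<close>

abbreviation "E i \<equiv> \<pi> (e i)"
abbreviation "F i \<equiv> \<pi> (f i)"

lemma dual_iff:
  "\<phi> \<in> dual_space sh \<longleftrightarrow> (\<forall>x y. \<phi> (x + y) = \<phi> x + \<phi> y) \<and> (\<forall>c x. \<phi> (sh c x) = c * \<phi> x)"
  by (rule dual_space_iff) unfold_locales

lemma dual_closed:
  "0 \<in> dual_space sh"
  "\<phi> \<in> dual_space sh \<Longrightarrow> \<psi> \<in> dual_space sh \<Longrightarrow> \<phi> + \<psi> \<in> dual_space sh"
  "\<phi> \<in> dual_space sh \<Longrightarrow> - \<phi> \<in> dual_space sh"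
  "\<phi> \<in> dual_space sh \<Longrightarrow> \<psi> \<in> dual_space sh \<Longrightarrow> \<phi> - \<psi> \<in> dual_space sh"
  by (auto simp: dual_iff algebra_simps)

lemma simple_comb_dual: "simple_comb \<alpha> m \<in> dual_space sh"
  using contra.simple_roots_dual
  by (auto simp: dual_iff simple_comb_def sum.distrib sum_distrib_left algebra_simps)

lemma pi_simps:
  "\<pi> (x + y) = \<pi> x + \<pi> y" "\<pi> (smul Gt c x) = smul G c (\<pi> x)" "\<pi> 0 = 0"
proof -
  interpret l: Vector_Spaces.linear "smul Gt" "smul G" \<pi> by (rule contra.quot.hom_linear)
  show "\<pi> (x + y) = \<pi> x + \<pi> y" "\<pi> (smul Gt c x) = smul G c (\<pi> x)" "\<pi> 0 = 0"
    by (simp_all add: l.add l.scale l.zero)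
qed

lemma pi_eval: "\<pi> (eval_term Gt \<iota>t e f x) = eval_term G \<iota> E F x"
  by (induction x) (simp_all add: pi_simps contra.quot.hom_brk contra.\<iota>_eq)

lemma eval_surj: "surj (eval_term G \<iota> E F)"
proof -
  have "surj (\<pi> \<circ> eval_term Gt \<iota>t e f)"
    using contra.quot_surj contra.generated by (rule comp_surj[rotated])
  then show ?thesis by (simp add: comp_def pi_eval)
qed

text \<open>Evaluation in \<open>Gt\<close> identifies terms exactly modulo \<open>tilde_eq\<close>,
  and \<pi> carries it to evaluation in \<open>G\<close>; so every relation of the presentation
  passes to the quotient.\<close>

lemma relation:
  assumes "tilde_eq sh \<tau> \<alpha> \<alpha>v x y"
  shows "eval_term G \<iota> E F x = eval_term G \<iota> E F y"
  using assms contra.presented[of x y] by (metis pi_eval)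

lemma iota_simps: "\<iota> (h + k) = \<iota> h + \<iota> k" "\<iota> (sh c h) = smul G c (\<iota> h)"
  \<comment> \<open>Rules 21 and 22 of \<open>tilde_eq\<close> are the linearity of
    \<open>GenH\<close>; rules 23 to 26, used below, are the defining relations.\<close>
  using relation[OF tilde_eq.intros(21)] relation[OF tilde_eq.intros(22)] by simp_all

lemma iota_0 [simp]: "\<iota> 0 = 0"
  using iota_simps(2)[of 0 0] by simp

lemma range_iota:
  "0 \<in> range \<iota>"
  "x \<in> range \<iota> \<Longrightarrow> y \<in> range \<iota> \<Longrightarrow> x + y \<in> range \<iota>"
  "x \<in> range \<iota> \<Longrightarrow> smul G c x \<in> range \<iota>"
  by (auto simp: image_iff simp flip: iota_simps intro: exI[of _ 0])

lemma iota_uminus: "\<iota> (- h) = - \<iota> h"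
  using iota_simps(1)[of h "- h"] by (simp add: eq_neg_iff_add_eq_0 add.commute)

lemma iota_sum: "\<iota> (sum u K) = (\<Sum>k\<in>K. \<iota> (u k))"
  by (induction K rule: infinite_finite_induct) (simp_all add: iota_simps)

lemma brk_E_F: "brk G (E i) (F j) = (if i = j then \<iota> (\<alpha>v i) else 0)"
  using relation[OF tilde_eq.intros(23)[of sh \<tau> \<alpha> \<alpha>v i j]] by (auto split: if_splits)

lemma E_root: "E i \<in> root_space G \<iota> (\<alpha> i)"
  and F_root: "F i \<in> root_space G \<iota> (- \<alpha> i)"
  and iota_root: "\<iota> h \<in> root_space G \<iota> 0"
  using relation[OF tilde_eq.intros(24)] relation[OF tilde_eq.intros(25)]
    relation[OF tilde_eq.intros(26)]
  by (simp_all add: root_space_def)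

lemma iota_part [simp]: "\<iota> h \<in> part G 0"
  and E_part: "E i \<in> part G (gen_parity \<tau> i)"
  and F_part: "F i \<in> part G (gen_parity \<tau> i)"
  using contra.gen_part contra.quot.hom_parity by (auto simp: contra.\<iota>_eq)

text \<open>The bracket case supplies homogeneous factors because the sign rules apply only to
  those. Closure under brackets is therefore proved for the span of the homogeneous elements
  satisfying \<open>Q\<close>; it contains the generators, hence everything.\<close>

lemma generate_induct:
  assumes gen: "\<And>h. Q (\<iota> h)" "\<And>i. Q (E i)" "\<And>i. Q (F i)"
    and lin: "\<And>x y. Q x \<Longrightarrow> Q y \<Longrightarrow> Q (x + y)" "\<And>c x. Q x \<Longrightarrow> Q (smul G c x)"
    and brk: "\<And>p q x y. x \<in> part G p \<Longrightarrow> y \<in> part G q \<Longrightarrow> Q x \<Longrightarrow> Q y \<Longrightarrow> Q (brk G x y)"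
  shows "Q x"
proof -
  let ?S = "{x. (\<exists>p. x \<in> part G p) \<and> Q x}"
  have *: "brk G x y \<in> g.span ?S" if "x \<in> g.span ?S" "y \<in> g.span ?S" for x y
    using that(1)
  proof (induction rule: g.span_induct_alt)
    case base
    then show ?case by (simp add: g.brk_simps g.span_zero)
  next
    case (step c z x)
    have "brk G z y \<in> g.span ?S"
    proof (rule g.span_brk[OF _ that(2)])
      fix w assume "w \<in> ?S"
      then show "brk G z w \<in> g.span ?S"
        using step(1) brk[of z _ w] g.brk_parity[of z _ w] by (intro g.span_base) blast
    qed
    with step show ?case by (simp add: g.brk_simps g.span_add g.span_scale)
  qed
  have "eval_term G \<iota> E F s \<in> g.span ?S" for s
  proof (induction s)
    case (GenH h) show ?case using gen iota_part[of h] by (auto intro!: g.span_base simp del: iota_part)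
  next
    case (GenE i) show ?case using gen E_part[of i] by (auto intro!: g.span_base)
  next
    case (GenF i) show ?case using gen F_part[of i] by (auto intro!: g.span_base)
  qed (auto intro: g.span_zero g.span_add g.span_scale *)
  then have "x \<in> g.span ?S" using surjD[OF eval_surj, of x] by auto
  then show ?thesis
  proof (induction rule: g.span_induct_alt)
    case base
    show ?case using lin(2)[OF gen(1)[of 0], of 0] by simp
  qed (auto intro: lin)
qed

text \<open>Bracketing with a generator preserves the span, and by Jacobi so does bracketing with
  any element. As the span contains the generators, it contains every bracket expression in
  them.\<close>

lemma triangular:
  "g.span ({x. \<exists>m. iter_brk G E m x} \<union> range \<iota> \<union> {x. \<exists>m. iter_brk G F m x}) = UNIV"
  (is "g.span ?W = UNIV")
proof -
  let ?P = "{x. \<exists>m. iter_brk G E m x} \<union> range \<iota>"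
  let ?N = "{x. \<exists>m. iter_brk G F m x} \<union> range \<iota>"
  have P: "g.span ?P \<subseteq> g.span ?W" and N: "g.span ?N \<subseteq> g.span ?W"
    by (rule g.span_mono; auto)+
  have FE: "brk G (F i) (E j) \<in> range \<iota>" for i j
    using g.super_antisym[OF F_part E_part, of i j] brk_E_F[of j i]
    by (auto simp: range_iota iota_simps(2)[symmetric] iota_uminus[symmetric] split: if_splits)
  have EF: "brk G (E i) (F j) \<in> range \<iota>" for i j
    using brk_E_F[of i j] by (auto simp: range_iota)
  have wE: "brk G (\<iota> h) x = smul G (simple_comb \<alpha> m h) x" if "iter_brk G E m x" for h m x
    using g.iter_brk_weight[of \<iota> E \<alpha>, OF iota_part E_root that] by (simp add: root_space_def)
  have wF: "brk G (\<iota> h) x = smul G (simple_comb (\<lambda>i. - \<alpha> i) m h) x" if "iter_brk G F m x" for h m x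
    using g.iter_brk_weight[of \<iota> F "\<lambda>i. - \<alpha> i", OF iota_part F_root that]
    by (simp add: root_space_def)
  have W: "y \<in> g.span ?W" if "y \<in> ?W" for y by (rule g.span_base[OF that])
  have adh: "brk G (\<iota> h) y \<in> g.span ?W" if "y \<in> ?W" for h y
    using that g.span_scale[OF W[OF that]] iota_root
    by (auto simp: wE wF root_space_def g.span_zero)
  have adE: "brk G (E i) y \<in> g.span ?W" if y: "y \<in> ?W" for i y
  proof -
    consider m where "iter_brk G E m y" | h where "y = \<iota> h" | m where "iter_brk G F m y"
      using y by auto
    then show ?thesis
    proof cases
      case 1
      then show ?thesis by (intro W) (blast intro: iter_brk.step)
    next
      case 2
      have "brk G (E i) y = - smul G (\<alpha> i h) (E i)"
        using E_root[of i] unfolding 2 g.brk_even_antisym[OF iota_part] root_space_def by simp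
      moreover have "E i \<in> g.span ?W" using iter_brk.single[of G E i] by (intro W) blast
      ultimately show ?thesis by (simp add: g.span_scale g.span_neg)
    next
      case 3
      \<comment> \<open>The roles are exchanged here: \<open>E\<close> is opposite to the monomials
        in \<open>F\<close>, whose weights are built from - \<alpha> i.\<close>
      then show ?thesis
        using g.brk_iter_brk_opposite[of \<iota> F "\<lambda>i. - \<alpha> i" "gen_parity \<tau>" E, OF iota_part F_root
            F_part E_part EF] N by blast
    qed
  qed
  have adF: "brk G (F i) y \<in> g.span ?W" if y: "y \<in> ?W" for i y
  proof -
    consider m where "iter_brk G E m y" | h where "y = \<iota> h" | m where "iter_brk G F m y"
      using y by auto
    then show ?thesis
    proof cases
      case 3
      then show ?thesis by (intro W) (blast intro: iter_brk.step)
    next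
      case 2
      have "brk G (F i) y = smul G (\<alpha> i h) (F i)"
        using F_root[of i] unfolding 2 g.brk_even_antisym[OF iota_part] root_space_def by simp
      moreover have "F i \<in> g.span ?W" using iter_brk.single[of G F i] by (intro W) blast
      ultimately show ?thesis by (simp add: g.span_scale)
    next
      case 1
      then show ?thesis
        using g.brk_iter_brk_opposite[of \<iota> E \<alpha> "gen_parity \<tau>" F, OF iota_part E_root
            E_part F_part FE] P by blast
    qed
  qed
  have ad: "\<forall>y \<in> g.span ?W. brk G x y \<in> g.span ?W" for x
  proof (induction x rule: generate_induct)
    case (1 h) show ?case using g.span_brk[of ?W "\<iota> h" ?W] adh by blast
  next
    case (2 i) show ?case using g.span_brk[of ?W "E i" ?W] adE by blast
  next
    case (3 i) show ?case using g.span_brk[of ?W "F i" ?W] adF by blast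
  next
    case (4 x y) then show ?case by (simp add: g.brk_simps g.span_add)
  next
    case (5 c x) then show ?case by (simp add: g.brk_simps g.span_scale)
  next
    case (6 p q x y)
    show ?case
    proof
      fix z assume z: "z \<in> g.span ?W"
      have "brk G (brk G x y) z
          = brk G x (brk G y z) - smul G (koszul_sign p q) (brk G y (brk G x z))"
        using g.super_jacobi[OF 6(1,2), of z] by simp
      with z 6 show "brk G (brk G x y) z \<in> g.span ?W" by (simp add: g.span_diff g.span_scale)
    qed
  qed
  have "eval_term G \<iota> E F s \<in> g.span ?W" for s
  proof (induction s)
    case (GenH h) show ?case by (intro W) simp
  next
    case (GenE i) show ?case using iter_brk.single[of G E i] by (intro W) auto
  next
    case (GenF i) show ?case using iter_brk.single[of G F i] by (intro W) auto
  next
    case (Br s s') then show ?case using ad by simp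
  qed (simp_all add: g.span_zero g.span_add g.span_scale)
  then have "x \<in> g.span ?W" for x using surjD[OF eval_surj, of x] by auto
  then show ?thesis by blast
qed

section \<open>Weights and parities of the root spaces\<close>

lemma simple_roots_coeff_zero:
  fixes c :: "'i \<Rightarrow> complex"
  assumes c: "\<And>h. (\<Sum>i\<in>UNIV. c i * \<alpha> i h) = 0"
  shows "c i = 0"
proof -
  interpret fm: module "\<lambda>c (\<phi> :: 'h \<Rightarrow> complex) h. c * \<phi> h" by (rule module_fun)
  let ?u = "\<lambda>v. c (inv \<alpha> v)"
  have "(\<Sum>v\<in>range \<alpha>. (\<lambda>h. ?u v * v h)) = (\<Sum>i\<in>UNIV. (\<lambda>h. c i * \<alpha> i h))"
    by (simp add: sum.reindex[OF contra.simple_roots_independent(1)]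
        inv_f_f[OF contra.simple_roots_independent(1)])
  also have "\<dots> = 0"
  proof (rule ext)
    fix h
    have "(\<Sum>i\<in>K. (\<lambda>h. c i * \<alpha> i h)) h = (\<Sum>i\<in>K. c i * \<alpha> i h)" for K
      by (induction K rule: infinite_finite_induct) auto
    then show "(\<Sum>i\<in>UNIV. (\<lambda>h. c i * \<alpha> i h)) h = 0 h" using c by simp
  qed
  finally have sum0: "(\<Sum>v\<in>range \<alpha>. (\<lambda>h. ?u v * v h)) = 0" .
  have "?u (\<alpha> i) = 0"
  proof (rule ccontr)
    assume "?u (\<alpha> i) \<noteq> 0"
    then have "\<exists>u. (\<exists>v\<in>range \<alpha>. u v \<noteq> 0) \<and> (\<Sum>v\<in>range \<alpha>. (\<lambda>h. u v * v h)) = 0"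
      using sum0 by (intro exI[of _ ?u] conjI bexI[of _ "\<alpha> i"]) (auto simp only:)
    then have "fm.dependent (range \<alpha>)"
      by (subst fm.dependent_finite) (simp_all only: finite_imageI finite_class.finite_UNIV)
    with contra.simple_roots_independent(2) show False by contradiction
  qed
  then show ?thesis by (simp add: inv_f_f[OF contra.simple_roots_independent(1)])
qed

lemma simple_comb_eq_iff: "simple_comb \<alpha> m = simple_comb \<alpha> n \<longleftrightarrow> m = n"
proof
  assume eq: "simple_comb \<alpha> m = simple_comb \<alpha> n"
  have "of_nat (m i) - of_nat (n i) = (0 :: complex)" for i
  proof (rule simple_roots_coeff_zero[of "\<lambda>i. of_nat (m i) - of_nat (n i)"])
    fix h
    show "(\<Sum>i\<in>UNIV. (of_nat (m i) - of_nat (n i)) * \<alpha> i h) = 0"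
      using fun_cong[OF eq, of h] by (simp add: simple_comb_def sum_subtractf left_diff_distrib)
  qed
  then show "m = n" by auto
qed auto

text \<open>Independence of the simple roots gives m i + n i = 0, and natural numbers admit no
  cancellation. This separates positive from negative weights.\<close>

lemma simple_comb_eq_minus_iff:
  "simple_comb \<alpha> m = - simple_comb \<alpha> n \<longleftrightarrow> m = (\<lambda>_. 0) \<and> n = (\<lambda>_. 0)"
proof
  assume eq: "simple_comb \<alpha> m = - simple_comb \<alpha> n"
  have "of_nat (m i) + of_nat (n i) = (0 :: complex)" for i
  proof (rule simple_roots_coeff_zero[of "\<lambda>i. of_nat (m i) + of_nat (n i)"])
    fix h
    show "(\<Sum>i\<in>UNIV. (of_nat (m i) + of_nat (n i)) * \<alpha> i h) = 0"
      using fun_cong[OF eq, of h] by (simp add: simple_comb_def sum.distrib distrib_right)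
  qed
  then have "m i + n i = 0" for i by (metis of_nat_add of_nat_eq_0_iff)
  then show "m = (\<lambda>_. 0) \<and> n = (\<lambda>_. 0)" by (auto simp: fun_eq_iff)
qed auto

text \<open>
  A priori smaller than the root space; the subspaces \<open>good \<gamma>\<close> span everything by the triangular
  decomposition, and weight vectors of distinct weights are independent, so it is all of it.
\<close>

definition good :: "('h \<Rightarrow> complex) \<Rightarrow> 'g set" where
  "good \<gamma> = {x \<in> root_space G \<iota> \<gamma>.
     (\<gamma> = 0 \<longrightarrow> x \<in> range \<iota>) \<and>
     (\<forall>m. \<gamma> = simple_comb \<alpha> m \<or> \<gamma> = - simple_comb \<alpha> m \<longrightarrow>
        x \<in> part G (comb_parity (gen_parity \<tau>) m)) \<and>
     ((\<nexists>m. \<gamma> = simple_comb \<alpha> m \<or> \<gamma> = - simple_comb \<alpha> m) \<longrightarrow> x = 0)}"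

lemma root_space_good: "root_space G \<iota> \<gamma> = good \<gamma>"
proof -
  have sub: "g.subspace (good \<gamma>)" for \<gamma>
    unfolding good_def using g.subspace_root_space[of \<iota> \<gamma>]
    by (simp add: g.subspace_def g.part_add g.part_scale range_iota)
  have H: "\<iota> h \<in> good 0" for h
    using iota_root[of h] simple_comb_eq_iff[of "\<lambda>_. 0"] simple_comb_eq_minus_iff[of "\<lambda>_. 0"]
    by (auto simp: good_def simple_comb_0[of \<alpha>, symmetric] simp del: simple_comb_0)
  \<comment> \<open>A monomial has nonzero \<open>m\<close>, so its weight is nonzero and the Cartan
    clause of \<open>good\<close> is vacuous; the weight determines \<open>m\<close>, so the parity
    clause concerns this \<open>m\<close> alone.\<close>
  have P: "x \<in> good (simple_comb \<alpha> m)" if "iter_brk G E m x" for m x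
    using g.iter_brk_weight[of \<iota> E \<alpha>, OF iota_part E_root that]
      g.iter_brk_parity[of E "gen_parity \<tau>", OF E_part that] iter_brk_nonzero[OF that]
      simple_comb_eq_iff[of m "\<lambda>_. 0"]
    by (auto simp: good_def simple_comb_eq_iff simple_comb_eq_minus_iff)
  have N: "x \<in> good (- simple_comb \<alpha> m)" if "iter_brk G F m x" for m x
    using g.iter_brk_weight[of \<iota> F "\<lambda>i. - \<alpha> i", OF iota_part F_root that]
      g.iter_brk_parity[of F "gen_parity \<tau>", OF F_part that] iter_brk_nonzero[OF that]
      simple_comb_eq_iff[of m "\<lambda>_. 0"] simple_comb_eq_minus_iff
    by (auto simp: good_def simple_comb_eq_iff simple_comb_uminus eq_commute[of "- _" "simple_comb _ _"])
  have "{x. \<exists>m. iter_brk G E m x} \<union> range \<iota> \<union> {x. \<exists>m. iter_brk G F m x} \<subseteq> (\<Union>\<gamma>. good \<gamma>)"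
    using H by (auto dest!: P N)
  from g.span_mono[OF this] have "g.span (\<Union>\<gamma>. good \<gamma>) = UNIV"
    unfolding triangular by (rule top_le)
  then have "x \<in> good \<gamma>" if "x \<in> root_space G \<iota> \<gamma>" for x
    using sub _ that by (rule g.root_component) (simp add: good_def)
  then show ?thesis by (auto simp: good_def)
qed

text \<open>The clause of \<open>good\<close> at weight zero. It puts brackets of root vectors of
  opposite weights into the Cartan subalgebra.\<close>

lemma root_space_zero: "root_space G \<iota> 0 = range \<iota>"
  using root_space_good[of 0] iota_root by (auto simp: good_def)

lemma root_space_part:
  assumes "x \<in> root_space G \<iota> (simple_comb \<alpha> m) \<or> x \<in> root_space G \<iota> (- simple_comb \<alpha> m)"
  shows "x \<in> part G (comb_parity (gen_parity \<tau>) m)"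
  using assms unfolding root_space_good by (auto simp: good_def)

lemma weight_cases:
  assumes "x \<in> root_space G \<iota> \<gamma>" "x \<noteq> 0"
  obtains m where "\<gamma> = simple_comb \<alpha> m" | m where "\<gamma> = - simple_comb \<alpha> m"
  using assms unfolding root_space_good by (auto simp: good_def)

subsection \<open>The form on the root spaces\<close>

lemmas form_simps = bilinear_mapD[OF inv.form_bilinear]

abbreviation "\<Delta>\<^sub>p \<equiv> pos_roots sh G \<iota> \<alpha>"

lemma zero_notin_pos_roots: "0 \<notin> \<Delta>\<^sub>p"
  by (simp add: pos_roots_def roots_def)

lemma pos_rootI:
  assumes "x \<in> root_space G \<iota> (simple_comb \<alpha> m)" "x \<noteq> 0" "m \<noteq> (\<lambda>_. 0)"
  shows "simple_comb \<alpha> m \<in> \<Delta>\<^sub>p"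
  using assms simple_comb_eq_iff[of m "\<lambda>_. 0"] simple_comb_dual[of m]
  by (auto simp: pos_roots_def roots_def)

text \<open>A nonzero vector of weight \<beta> must pair nontrivially with some vector of weight -
  \<beta>.\<close>

lemma roots_uminus:
  assumes "\<beta> \<in> roots sh G \<iota>"
  shows "- \<beta> \<in> roots sh G \<iota>"
proof -
  obtain x where x: "x \<in> root_space G \<iota> \<beta>" "x \<noteq> 0"
    using assms by (auto simp: roots_def)
  then obtain y where "y \<in> root_space G \<iota> (- \<beta>)" "form x y \<noteq> 0"
    using inv.form_pairing(1)[OF assms, of x] by blast
  moreover from this(2) have "y \<noteq> 0" using form_simps(6)[of x] by metis
  moreover have "\<beta> \<noteq> 0" "- \<beta> \<in> dual_space sh"
    using assms dual_closed(3)[of \<beta>] by (auto simp: roots_def)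
  ultimately show ?thesis unfolding roots_def by (simp; blast)
qed

lemma simple_pos_root:
  assumes "x \<in> root_space G \<iota> (\<alpha> j) \<or> x \<in> root_space G \<iota> (- \<alpha> j)" "x \<noteq> 0"
  shows "\<alpha> j \<in> \<Delta>\<^sub>p"
proof -
  let ?m = "(\<lambda>_. 0)(j := Suc 0)"
  have m: "\<alpha> j = simple_comb \<alpha> ?m" by (rule simple_comb_single[symmetric])
  have "?m \<noteq> (\<lambda>_. 0)" by (auto simp: fun_eq_iff)
  then have nz: "\<alpha> j \<noteq> 0" unfolding m using simple_comb_eq_iff[of ?m "\<lambda>_. 0"] by simp
  have "\<alpha> j \<in> roots sh G \<iota> \<or> - \<alpha> j \<in> roots sh G \<iota>"
    using assms nz contra.simple_roots_dual[of j] dual_closed(3)[of "\<alpha> j"]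
    by (auto simp: roots_def)
  then have "\<alpha> j \<in> roots sh G \<iota>" using roots_uminus[of "- \<alpha> j"] by auto
  then show ?thesis using m by (auto simp: pos_roots_def)
qed

text \<open>The shift changes one coefficient of \<beta> by one, while a weight with a nonzero
  vector has coefficients of one sign. So the positive roots can be left only by subtracting
  \<alpha> j from \<beta> = \<alpha> j.\<close>

lemma pos_root_shift:
  assumes \<beta>: "\<beta> \<in> \<Delta>\<^sub>p" and \<xi>: "\<xi> = \<alpha> j \<or> \<xi> = - \<alpha> j"
    and x: "x \<in> root_space G \<iota> (\<beta> + \<xi>)" "x \<noteq> 0"
  shows "\<beta> + \<xi> \<in> \<Delta>\<^sub>p \<or> \<xi> = - \<beta>"
proof -
  obtain m where m: "\<beta> = simple_comb \<alpha> m" using \<beta> by (auto simp: pos_roots_def)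
  have m0: "m \<noteq> (\<lambda>_. 0)" using \<beta> m zero_notin_pos_roots by auto
  from x show ?thesis
  proof (cases rule: weight_cases)
    case (1 n)
    show ?thesis
    proof (cases "n = (\<lambda>_. 0)")
      case True
      with 1 show ?thesis by (simp add: add_eq_0_iff)
    next
      case False
      with x 1 show ?thesis using pos_rootI[of x n] by simp
    qed
  next
    case (2 n)
    have "\<xi> = - \<alpha> j"
    proof (rule ccontr)
      assume "\<xi> \<noteq> - \<alpha> j"
      then have "simple_comb \<alpha> (m(j := Suc (m j))) = - simple_comb \<alpha> n"
        using 2 \<xi> m by (simp add: simple_comb_Suc add.commute)
      then show False using simple_comb_eq_minus_iff by (metis fun_upd_same nat.distinct(1))
    qed
    \<comment> \<open>The equation \<beta> - \<alpha> j = - \<open>simple_comb \<alpha> n\<close>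
      says that m + n is the unit vector at j; as m is nonzero, it is all of that vector.\<close>
    define l where "l = (\<lambda>i. m i + n i)"
    have "simple_comb \<alpha> l = simple_comb \<alpha> m + simple_comb \<alpha> n"
      by (auto simp: l_def simple_comb_def fun_eq_iff algebra_simps sum.distrib)
    also have "\<dots> = \<alpha> j"
      using 2 m \<open>\<xi> = - \<alpha> j\<close> by (simp add: algebra_simps)
    finally have "l = (\<lambda>_. 0)(j := Suc 0)"
      using simple_comb_eq_iff simple_comb_single by metis
    then have l: "m i + n i = ((\<lambda>_. 0)(j := Suc 0)) i" for i by (metis l_def)
    have "m = (\<lambda>_. 0)(j := Suc 0)"
    proof (rule ext)
      fix i
      have "m i \<noteq> 0" if "i = j"
      proof
        assume "m i = 0"
        then have "m k = 0" for k using l[of k] that by (cases "k = j") auto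
        with m0 show False by auto
      qed
      with l[of i] show "m i = ((\<lambda>_. 0)(j := Suc 0)) i" by (cases "i = j") auto
    qed
    then have "\<beta> = \<alpha> j" using m simple_comb_single by simp
    then show ?thesis using \<open>\<xi> = - \<alpha> j\<close> by simp
  qed
qed

lemma height_simple_comb: "height \<alpha> (simple_comb \<alpha> m) = (\<Sum>i\<in>UNIV. m i)"
  unfolding height_def by (rule the_equality) (auto simp: simple_comb_eq_iff)

lemma finite_low_roots: "finite {\<beta> \<in> \<Delta>\<^sub>p. height \<alpha> \<beta> < N}"
proof (rule finite_subset)
  show "{\<beta> \<in> \<Delta>\<^sub>p. height \<alpha> \<beta> < N} \<subseteq> simple_comb \<alpha> ` {m. (\<Sum>i\<in>UNIV. m i) < N}"
    by (auto simp: pos_roots_def height_simple_comb)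
qed (intro finite_imageI finite_nat_funs_bounded)

lemma form_iota_commute: "form (\<iota> h) (\<iota> k) = form (\<iota> k) (\<iota> h)"
  using inv.form_supersym[of "\<iota> h" 0 "\<iota> k" 0] by simp

lemma form_iota_ext:
  assumes "\<And>h. form (\<iota> k) (\<iota> h) = form (\<iota> k') (\<iota> h)"
  shows "k = k'"
  using inv.form_nondegenerate_h(1)[of "k - k'"] assms
  by (simp add: iota_simps(1)[of k "- k'", simplified] iota_uminus form_simps)

end

section \<open>Tensor products and the Casimir operator\<close>

text \<open>Puts sums over different supports on one common finite index set, from which additivity
  follows.\<close>

lemma tensor_eval_superset:
  assumes "module s" "finite K" "Poly_Mapping.keys u \<subseteq> K"
  shows "tensor_eval s t u = (\<Sum>k\<in>K. s (Poly_Mapping.lookup u k) (t (fst k) (snd k)))"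
proof -
  interpret module s by fact
  show ?thesis
    unfolding tensor_eval_def
    by (rule sum.mono_neutral_left) (use assms in \<open>auto simp: in_keys_iff\<close>)
qed

lemma tensor_eval_diff:
  assumes "module s"
  shows "tensor_eval s t (u - w) = tensor_eval s t u - tensor_eval s t w"
proof -
  interpret module s by fact
  let ?K = "Poly_Mapping.keys u \<union> Poly_Mapping.keys w \<union> Poly_Mapping.keys (u - w)"
  have *: "finite ?K" "Poly_Mapping.keys u \<subseteq> ?K" "Poly_Mapping.keys w \<subseteq> ?K"
    "Poly_Mapping.keys (u - w) \<subseteq> ?K" by auto
  show ?thesis
    by (simp only: tensor_eval_superset[OF assms *(1,2)] tensor_eval_superset[OF assms *(1,3)]
        tensor_eval_superset[OF assms *(1,4)] lookup_minus scale_left_diff_distrib sum_subtractf)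
qed

lemma tensor_eval_single:
  assumes "module s"
  shows "tensor_eval s t (Poly_Mapping.single (x, y) c) = s c (t x y)"
  using tensor_eval_superset[OF assms, of "{(x, y)}" "Poly_Mapping.single (x, y) c" t]
  by (simp add: split: if_splits)

lemma module_poly_mapping:
  "module (\<lambda>c. Poly_Mapping.map ((*) c) :: ('k \<Rightarrow>\<^sub>0 complex) \<Rightarrow> 'k \<Rightarrow>\<^sub>0 complex)"
proof -
  have [simp]: "Poly_Mapping.lookup (Poly_Mapping.map ((*) c) u) k = c * Poly_Mapping.lookup u k"
    for c :: complex and u :: "'k \<Rightarrow>\<^sub>0 complex" and k
    by (simp add: Poly_Mapping.map.rep_eq when_def)
  show ?thesis
    by unfold_locales (simp_all add: poly_mapping_eq_iff fun_eq_iff lookup_add algebra_simps)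
qed

text \<open>Each relator lies in the kernel of \<open>tensor_eval\<close>, and evaluating it there
  yields the corresponding bilinearity law for \<open>t\<close>.\<close>

lemma tensor_product_bilinear:
  assumes "vector_space s1" "vector_space s2" "vector_space s3" "is_tensor_product s1 s2 s3 t"
  shows "bilinear_map s1 s2 s3 t"
proof -
  interpret v3: vector_space s3 by fact
  have m3: "module s3" by unfold_locales
  interpret pm: module "\<lambda>c. Poly_Mapping.map ((*) c) :: (('a \<times> 'b) \<Rightarrow>\<^sub>0 complex) \<Rightarrow> _"
    by (rule module_poly_mapping)
  have ker: "tensor_eval s3 t u = 0" if "u \<in> tensor_relators s1 s2" for u
    using assms(4) pm.span_base[OF that] unfolding is_tensor_product_def by auto
  note ev = tensor_eval_diff[OF m3] tensor_eval_single[OF m3]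
  have "t (x + x') y = t x y + t x' y" for x x' y
  proof -
    have "Poly_Mapping.single (x + x', y) 1 - Poly_Mapping.single (x, y) 1 - Poly_Mapping.single (x', y) 1 \<in> tensor_relators s1 s2"
      unfolding tensor_relators_def by blast
    from ker[OF this] show ?thesis by (simp add: ev) (simp add: algebra_simps)?
  qed
  moreover have "t x (y + y') = t x y + t x y'" for x y y'
  proof -
    have "Poly_Mapping.single (x, y + y') 1 - Poly_Mapping.single (x, y) 1 - Poly_Mapping.single (x, y') 1 \<in> tensor_relators s1 s2"
      unfolding tensor_relators_def by blast
    from ker[OF this] show ?thesis by (simp add: ev) (simp add: algebra_simps)?
  qed
  moreover have "t (s1 c x) y = s3 c (t x y)" for c x y
  proof -
    have "Poly_Mapping.single (s1 c x, y) 1 - Poly_Mapping.single (x, y) c \<in> tensor_relators s1 s2"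
      unfolding tensor_relators_def by blast
    from ker[OF this] show ?thesis by (simp add: ev) (simp add: algebra_simps)?
  qed
  moreover have "t x (s2 c y) = s3 c (t x y)" for c x y
  proof -
    have "Poly_Mapping.single (x, s2 c y) 1 - Poly_Mapping.single (x, y) c \<in> tensor_relators s1 s2"
      unfolding tensor_relators_def by blast
    from ker[OF this] show ?thesis by (simp add: ev) (simp add: algebra_simps)?
  qed
  ultimately show ?thesis
    using assms(1-3) by (auto simp: bilinear_map_def Vector_Spaces.linear_iff)
qed

lemma is_basis_expansion:
  fixes s :: "complex \<Rightarrow> 'c::ab_group_add \<Rightarrow> 'c"
  assumes "vector_space s" "is_basis s n b S" "x \<in> S"
  obtains c where "x = (\<Sum>i<n. s (c i) (b i))"
proof -
  interpret v: vector_space s by fact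
  have "x \<in> v.span (b ` {..<n})" using assms by (simp add: is_basis_def)
  then obtain u where "x = (\<Sum>v\<in>b ` {..<n}. s (u v) v)"
    by (auto simp: v.span_finite)
  also have "\<dots> = (\<Sum>i<n. s (u (b i)) (b i))"
    using assms by (simp add: is_basis_def sum.reindex)
  finally show ?thesis by (rule that)
qed

text \<open>Translation is a bijection. Used to align the lower term at \<beta> + \<xi> with the
  upper term at \<beta>.\<close>

lemma Sum_any_shift:
  fixes g :: "'k::ab_group_add \<Rightarrow> 'm::comm_monoid_add"
  shows "Sum_any (\<lambda>\<beta>. g (\<beta> + \<xi>)) = Sum_any g"
proof (rule Sum_any.reindex_cong[symmetric])
  show "bij (\<lambda>\<beta>. \<beta> + \<xi>)" by (rule bij_betw_byWitness[where f' = "\<lambda>\<beta>. \<beta> - \<xi>"]) auto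
qed (simp add: comp_def)

section \<open>The operators x(c) on a module in category O\<close>

locale casimir =
  contragredient_form sh A \<alpha> \<alpha>v Gt \<tau> \<iota>t e f G \<pi> R \<iota> form +
  gb: lie_superalgebra GB +
  loop: loop_superalgebra G sb GB t +
  mo: category_O_module sh G \<iota> \<alpha> GB t sv Dv act
  for sh :: "complex \<Rightarrow> 'h::ab_group_add \<Rightarrow> 'h"
    and A :: "complex ^ 'i ^ 'i::finite"
    and \<alpha> :: "'i \<Rightarrow> 'h \<Rightarrow> complex" and \<alpha>v :: "'i \<Rightarrow> 'h"
    and Gt :: "'t::ab_group_add superalg" and \<tau> :: "'i set"
    and \<iota>t :: "'h \<Rightarrow> 't" and e f :: "'i \<Rightarrow> 't"
    and G :: "'g::ab_group_add superalg" and \<pi> :: "'t \<Rightarrow> 'g" and R :: "'t set"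
    and \<iota> :: "'h \<Rightarrow> 'g" and form :: "'g \<Rightarrow> 'g \<Rightarrow> complex"
    and sb :: "complex \<Rightarrow> 'b::comm_ring_1 \<Rightarrow> 'b"
    and GB :: "'gb::ab_group_add superalg" and t :: "'g \<Rightarrow> 'b \<Rightarrow> 'gb"
    and sv :: "complex \<Rightarrow> 'v::ab_group_add \<Rightarrow> 'v" and Dv :: "bit \<Rightarrow> 'v set"
    and act :: "'gb \<Rightarrow> 'v \<Rightarrow> 'v" +
  fixes \<rho> :: "'h \<Rightarrow> complex"
    and hb hc :: "nat \<Rightarrow> 'h" and eb fb :: "('h \<Rightarrow> complex) \<Rightarrow> nat \<Rightarrow> 'g"
  assumes rho: "is_rho sh \<alpha> \<iota> form \<rho>"
    and dual_h: "dual_bases_h sh \<iota> form hb hc"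
    and dual_roots: "dual_bases_roots sh G \<iota> \<alpha> form eb fb"
begin

abbreviation "X x c \<equiv> act (t x c)"
abbreviation "hof \<beta> \<equiv> h_of \<iota> form \<beta>"
abbreviation "n \<equiv> vector_space.dim sh UNIV"

lemma bilinear_t: "bilinear_map (smul G) sb (smul GB) t"
  by (rule tensor_product_bilinear[OF _ _ _ loop.tensor]) unfold_locales

lemmas t_simps = bilinear_mapD[OF bilinear_t]
lemmas act_simps = bilinear_mapD[OF mo.act_bilinear]

lemma X_simps:
  "X (x + y) c v = X x c v + X y c v" "X (smul G k x) c v = sv k (X x c v)"
  "X 0 c v = 0" "X (- x) c v = - X x c v" "X (sum u K) c v = (\<Sum>k\<in>K. X (u k) c v)"
  "X x c (v + w) = X x c v + X x c w" "X x c (sv k v) = sv k (X x c v)"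
  "X x c 0 = 0" "X x c (- v) = - X x c v" "X x c (sum z K) = (\<Sum>k\<in>K. X x c (z k))"
  "X x c (v - w) = X x c v - X x c w"
  by (simp_all add: t_simps act_simps)

lemma X_commute:
  assumes "x \<in> part G p" "y \<in> part G q"
  shows "X x c (X y d v) = X (brk G x y) (c * d) v + sv (koszul_sign p q) (X y d (X x c v))"
proof -
  have "t x c \<in> part GB p" "t y d \<in> part GB q"
    using assms by (auto simp: loop.part_tensor intro!: gb.span_base)
  from mo.act_brk[OF this, of v] show ?thesis
    by (simp add: loop.brk_tensor)
qed

subsection \<open>Dual bases\<close>

lemma hb_hc: "i < n \<Longrightarrow> j < n \<Longrightarrow> form (\<iota> (hb i)) (\<iota> (hc j)) = (if i = j then 1 else 0)"
  using dual_h by (simp add: dual_bases_h_def Let_def)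

lemma h_expand_hb: "h = (\<Sum>i<n. sh (form (\<iota> h) (\<iota> (hc i))) (hb i))"
proof -
  have "is_basis sh n hb UNIV" using dual_h by (simp add: dual_bases_h_def Let_def)
  then obtain c where c: "h = (\<Sum>i<n. sh (c i) (hb i))"
    by (rule is_basis_expansion[OF h.vector_space_axioms _ UNIV_I])
  have "form (\<iota> h) (\<iota> (hc j)) = c j" if "j < n" for j
    by (subst c) (use that in \<open>simp add: iota_sum iota_simps form_simps hb_hc if_distrib
      cong: if_cong\<close>)
  then show ?thesis using c by simp
qed

lemma h_expand_hc: "h = (\<Sum>i<n. sh (form (\<iota> h) (\<iota> (hb i))) (hc i))"
proof -
  have "is_basis sh n hc UNIV" using dual_h by (simp add: dual_bases_h_def Let_def)
  then obtain c where c: "h = (\<Sum>i<n. sh (c i) (hc i))"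
    by (rule is_basis_expansion[OF h.vector_space_axioms _ UNIV_I])
  have "form (\<iota> h) (\<iota> (hb j)) = c j" if "j < n" for j
    by (subst c, subst form_iota_commute) (use that in \<open>simp add: iota_sum iota_simps form_simps
      hb_hc if_distrib cong: if_cong\<close>)
  then show ?thesis using c by simp
qed

lemma dual_sum:
  assumes "\<beta> \<in> dual_space sh"
  shows "\<beta> (sum u K) = (\<Sum>k\<in>K. \<beta> (u k))" "\<beta> (sh c k) = c * \<beta> k" "\<beta> (- k) = - \<beta> k"
proof -
  have add: "\<beta> (x + y) = \<beta> x + \<beta> y" and sc: "\<beta> (sh c x) = c * \<beta> x" for x y c
    using assms by (auto simp: dual_iff)
  have 0: "\<beta> 0 = 0" using sc[of 0 0] by simp
  show "\<beta> (sum u K) = (\<Sum>k\<in>K. \<beta> (u k))"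
    by (induction K rule: infinite_finite_induct) (simp_all add: add 0)
  show "\<beta> (sh c k) = c * \<beta> k" by (rule sc)
  show "\<beta> (- k) = - \<beta> k" using add[of k "- k"] 0 by (simp add: eq_neg_iff_add_eq_0 add.commute)
qed

lemma form_hof:
  assumes "\<beta> \<in> dual_space sh"
  shows "form (\<iota> (hof \<beta>)) (\<iota> h) = \<beta> h"
proof -
  \<comment> \<open>The representing vector in the dual basis; it shows that the description
    \<open>THE\<close> in \<open>h_of\<close> denotes.\<close>
  let ?k = "\<Sum>i<n. sh (\<beta> (hb i)) (hc i)"
  have k: "form (\<iota> ?k) (\<iota> h) = \<beta> h" for h
  proof -
    have "\<beta> h = (\<Sum>i<n. form (\<iota> h) (\<iota> (hc i)) * \<beta> (hb i))"
      by (subst h_expand_hb[of h]) (simp add: dual_sum[OF assms])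
    then show ?thesis
      by (simp add: iota_sum iota_simps form_simps form_iota_commute[of _ h] mult.commute)
  qed
  have "hof \<beta> = ?k"
    unfolding h_of_def
    by (rule the_equality) (use k in \<open>auto intro!: form_iota_ext\<close>)
  with k show ?thesis by simp
qed

lemma hof_unique: "\<beta> \<in> dual_space sh \<Longrightarrow> (\<And>h. form (\<iota> k) (\<iota> h) = \<beta> h) \<Longrightarrow> hof \<beta> = k"
  by (rule form_iota_ext) (simp add: form_hof)

lemma hof_uminus: "\<beta> \<in> dual_space sh \<Longrightarrow> hof (- \<beta>) = - hof \<beta>"
  by (rule hof_unique) (simp_all add: dual_closed iota_uminus form_simps form_hof)

lemma hof_0: "hof 0 = 0"
  by (rule hof_unique) (simp_all add: dual_closed form_simps)

text \<open>The bracket has weight zero, hence lies in the Cartan subalgebra. Its pairing with h is,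
  by invariance, (x, [y, h]) = \<xi>(h) (x, y), and the form is non-degenerate there.\<close>

lemma brk_opposite:
  assumes "\<xi> \<in> dual_space sh" "x \<in> root_space G \<iota> \<xi>" "y \<in> root_space G \<iota> (- \<xi>)"
  shows "brk G x y = smul G (form x y) (\<iota> (hof \<xi>))"
proof -
  have "brk G x y \<in> root_space G \<iota> 0"
    using g.brk_root_space[OF iota_part assms(2,3)] by simp
  then obtain k where k: "brk G x y = \<iota> k" unfolding root_space_zero by blast
  have "form (\<iota> k) (\<iota> h) = form (\<iota> (sh (form x y) (hof \<xi>))) (\<iota> h)" for h
  proof -
    have "brk G y (\<iota> h) = smul G (\<xi> h) y"
      using assms(3) by (simp add: g.brk_even_antisym root_space_def)
    then show ?thesis
      by (simp add: k[symmetric] inv.form_invariant form_simps iota_simps form_hof[OF assms(1)])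
  qed
  then have "k = sh (form x y) (hof \<xi>)" by (rule form_iota_ext)
  then show ?thesis by (simp add: k iota_simps)
qed

abbreviation "m \<beta> \<equiv> mult G \<iota> \<beta>"

lemma eb_fb: "\<beta> \<in> \<Delta>\<^sub>p \<Longrightarrow> i < m \<beta> \<Longrightarrow> j < m \<beta> \<Longrightarrow>
    form (eb \<beta> i) (fb \<beta> j) = (if i = j then 1 else 0)"
  using dual_roots by (simp add: dual_bases_roots_def)

lemma
  assumes "\<beta> \<in> \<Delta>\<^sub>p" "i < m \<beta>"
  shows eb_root: "eb \<beta> i \<in> root_space G \<iota> \<beta>" and fb_root: "fb \<beta> i \<in> root_space G \<iota> (- \<beta>)"
proof -
  have "g.span (eb \<beta> ` {..<m \<beta>}) = root_space G \<iota> \<beta>"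
    "g.span (fb \<beta> ` {..<m \<beta>}) = root_space G \<iota> (- \<beta>)"
    using dual_roots assms(1) by (simp_all add: dual_bases_roots_def is_basis_def)
  then show "eb \<beta> i \<in> root_space G \<iota> \<beta>" "fb \<beta> i \<in> root_space G \<iota> (- \<beta>)"
    using g.span_base[of "eb \<beta> i" "eb \<beta> ` {..<m \<beta>}"]
      g.span_base[of "fb \<beta> i" "fb \<beta> ` {..<m \<beta>}"] assms(2) by simp_all
qed

lemma expand_eb:
  assumes "\<beta> \<in> \<Delta>\<^sub>p" "x \<in> root_space G \<iota> \<beta>"
  shows "x = (\<Sum>i<m \<beta>. smul G (form x (fb \<beta> i)) (eb \<beta> i))"
proof -
  have "is_basis (smul G) (m \<beta>) (eb \<beta>) (root_space G \<iota> \<beta>)"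
    using dual_roots assms(1) by (simp add: dual_bases_roots_def)
  then obtain c where c: "x = (\<Sum>i<m \<beta>. smul G (c i) (eb \<beta> i))"
    by (rule is_basis_expansion[OF g.vector_space_axioms _ assms(2)])
  have "form x (fb \<beta> j) = c j" if "j < m \<beta>" for j
    by (subst c) (use that in \<open>simp add: form_simps eb_fb[OF assms(1)] if_distrib
      cong: if_cong\<close>)
  then show ?thesis using c by simp
qed

lemma expand_fb:
  assumes "\<beta> \<in> \<Delta>\<^sub>p" "x \<in> root_space G \<iota> (- \<beta>)"
  shows "x = (\<Sum>i<m \<beta>. smul G (form (eb \<beta> i) x) (fb \<beta> i))"
proof -
  have "is_basis (smul G) (m \<beta>) (fb \<beta>) (root_space G \<iota> (- \<beta>))"
    using dual_roots assms(1) by (simp add: dual_bases_roots_def)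
  then obtain c where c: "x = (\<Sum>i<m \<beta>. smul G (c i) (fb \<beta> i))"
    by (rule is_basis_expansion[OF g.vector_space_axioms _ assms(2)])
  have "form (eb \<beta> j) x = c j" if "j < m \<beta>" for j
    by (subst c) (use that in \<open>simp add: form_simps eb_fb[OF assms(1)] if_distrib
      cong: if_cong\<close>)
  then show ?thesis using c by simp
qed

lemma pos_root_dual: "\<beta> \<in> \<Delta>\<^sub>p \<Longrightarrow> \<beta> \<in> dual_space sh"
  by (simp add: pos_roots_def roots_def)

text \<open>One parity shared by the root spaces of \<beta> and - \<beta>, chosen so that the
  coefficients of \<beta> need not be carried along. It is meaningful for positive roots.\<close>

definition root_parity :: "('h \<Rightarrow> complex) \<Rightarrow> bit" where
  "root_parity \<beta> = (SOME q. root_space G \<iota> \<beta> \<subseteq> part G q \<and> root_space G \<iota> (- \<beta>) \<subseteq> part G q)"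

lemma root_parity:
  assumes "\<beta> \<in> \<Delta>\<^sub>p"
  shows "root_space G \<iota> \<beta> \<subseteq> part G (root_parity \<beta>)"
    "root_space G \<iota> (- \<beta>) \<subseteq> part G (root_parity \<beta>)"
proof -
  obtain k where "\<beta> = simple_comb \<alpha> k" using assms by (auto simp: pos_roots_def)
  then have "\<exists>q. root_space G \<iota> \<beta> \<subseteq> part G q \<and> root_space G \<iota> (- \<beta>) \<subseteq> part G q"
    using root_space_part by blast
  from someI_ex[OF this]
  show "root_space G \<iota> \<beta> \<subseteq> part G (root_parity \<beta>)"
    "root_space G \<iota> (- \<beta>) \<subseteq> part G (root_parity \<beta>)" by (simp_all add: root_parity_def)
qed

lemma
  assumes "\<beta> \<in> \<Delta>\<^sub>p" "i < m \<beta>"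
  shows eb_part: "eb \<beta> i \<in> part G (root_parity \<beta>)"
    and fb_part: "fb \<beta> i \<in> part G (root_parity \<beta>)"
  using root_parity[OF assms(1)] eb_root[OF assms] fb_root[OF assms] by auto

subsection \<open>Commutators with root vectors\<close>

abbreviation "\<Omega>\<^sub>r \<beta> a b v \<equiv> Omega_root G \<iota> eb fb t act \<beta> a b v"

text \<open>Extended by 0 off the positive roots, as are the next two terms, so that sums run over
  all weights and can be translated by \<xi>.\<close>

definition lower_term :: "'g \<Rightarrow> 'b \<Rightarrow> 'b \<Rightarrow> 'v \<Rightarrow> ('h \<Rightarrow> complex) \<Rightarrow> 'v" where
  "lower_term x a b v \<beta> =
     (if \<beta> \<in> \<Delta>\<^sub>p then \<Sum>i<m \<beta>. X (brk G x (fb \<beta> i)) a (X (eb \<beta> i) b v) else 0)"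

definition upper_term :: "bit \<Rightarrow> 'g \<Rightarrow> 'b \<Rightarrow> 'b \<Rightarrow> 'v \<Rightarrow> ('h \<Rightarrow> complex) \<Rightarrow> 'v" where
  "upper_term p x a b v \<beta> =
     (if \<beta> \<in> \<Delta>\<^sub>p then \<Sum>i<m \<beta>. sv (koszul_sign p (root_parity \<beta>))
        (X (fb \<beta> i) a (X (brk G x (eb \<beta> i)) b v)) else 0)"

definition root_term :: "'b \<Rightarrow> 'b \<Rightarrow> 'v \<Rightarrow> ('h \<Rightarrow> complex) \<Rightarrow> 'v" where
  "root_term a b v \<beta> = (if \<beta> \<in> \<Delta>\<^sub>p then \<Omega>\<^sub>r \<beta> a b v else 0)"

text \<open>Passing \<open>fb\<close> and then \<open>eb\<close> costs the same Koszul sign twice,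
  since both have parity \<open>root_parity \<beta>\<close>; the term where x has passed both
  therefore carries no sign.\<close>

lemma root_term_commutator:
  assumes x: "x \<in> part G p"
  shows "X x 1 (root_term a b v \<beta>)
    = root_term a b (X x 1 v) \<beta> + (lower_term x a b v \<beta> + upper_term p x a b v \<beta>)"
proof (cases "\<beta> \<in> \<Delta>\<^sub>p")
  case True
  let ?k = "koszul_sign p (root_parity \<beta>)"
  have "X x 1 (X (fb \<beta> i) a (X (eb \<beta> i) b v))
      = X (fb \<beta> i) a (X (eb \<beta> i) b (X x 1 v)) + (X (brk G x (fb \<beta> i)) a (X (eb \<beta> i) b v)
        + sv ?k (X (fb \<beta> i) a (X (brk G x (eb \<beta> i)) b v)))" if "i < m \<beta>" for i
    using X_commute[OF x fb_part[OF True that], of 1 a "X (eb \<beta> i) b v"]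
      X_commute[OF x eb_part[OF True that], of 1 b v]
    by (simp add: X_simps mo.V.scale_right_distrib)
  then show ?thesis
    using True by (simp add: root_term_def lower_term_def upper_term_def Omega_root_def X_simps
        sum.distrib)
qed (simp add: root_term_def lower_term_def upper_term_def X_simps)

text \<open>Expanded in the dual bases, both terms have the coefficients (e, [x, f]): by
  antisymmetry and invariance ([x, e], f) is minus the Koszul sign times (e, [x, f]), and the sign
  in \<open>upper_term\<close> absorbs the Koszul sign. A minus remains.\<close>

lemma upper_lower_cancel:
  assumes x: "x \<in> part G p" "x \<in> root_space G \<iota> \<xi>"
    and \<beta>: "\<beta> \<in> \<Delta>\<^sub>p" and \<gamma>: "\<beta> + \<xi> \<in> \<Delta>\<^sub>p"
  shows "upper_term p x a b v \<beta> + lower_term x a b v (\<beta> + \<xi>) = 0"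
proof -
  let ?\<gamma> = "\<beta> + \<xi>" and ?k = "koszul_sign p (root_parity \<beta>)"
  let ?c = "\<lambda>i k. form (eb \<beta> i) (brk G x (fb ?\<gamma> k))"
  let ?w = "\<lambda>i k. X (fb \<beta> i) a (X (eb ?\<gamma> k) b v)"
  have xe: "brk G x (eb \<beta> i) = (\<Sum>k<m ?\<gamma>. smul G (- ?k * ?c i k) (eb ?\<gamma> k))"
    if i: "i < m \<beta>" for i
  proof -
    have "brk G x (eb \<beta> i) \<in> root_space G \<iota> ?\<gamma>"
      using g.brk_root_space[OF iota_part x(2) eb_root[OF \<beta> i]] by (simp add: add.commute)
    moreover have "form (brk G x (eb \<beta> i)) (fb ?\<gamma> k) = - ?k * ?c i k" for k
      unfolding g.super_antisym[OF x(1) eb_part[OF \<beta> i]]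
      by (simp add: form_simps inv.form_invariant)
    ultimately show ?thesis using expand_eb[OF \<gamma>, of "brk G x (eb \<beta> i)"] by simp
  qed
  have xf: "brk G x (fb ?\<gamma> k) = (\<Sum>i<m \<beta>. smul G (?c i k) (fb \<beta> i))" if k: "k < m ?\<gamma>" for k
  proof -
    have "brk G x (fb ?\<gamma> k) \<in> root_space G \<iota> (- \<beta>)"
      using g.brk_root_space[OF iota_part x(2) fb_root[OF \<gamma> k]] by (simp add: algebra_simps)
    then show ?thesis using expand_fb[OF \<beta>] by blast
  qed
  have "upper_term p x a b v \<beta> = (\<Sum>i<m \<beta>. \<Sum>k<m ?\<gamma>. - sv (?c i k) (?w i k))"
    using \<beta> by (simp add: upper_term_def xe X_simps mo.V.scale_sum_right sum_negf)
  also have "\<dots> = - (\<Sum>k<m ?\<gamma>. \<Sum>i<m \<beta>. sv (?c i k) (?w i k))"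
    by (simp add: sum_negf) (rule sum.swap)
  also have "(\<Sum>k<m ?\<gamma>. \<Sum>i<m \<beta>. sv (?c i k) (?w i k)) = lower_term x a b v ?\<gamma>"
    using \<gamma> by (simp add: lower_term_def xf X_simps)
  finally show ?thesis by simp
qed

lemma upper_term_vanish:
  assumes "x \<in> root_space G \<iota> \<xi>" "\<xi> = \<alpha> j \<or> \<xi> = - \<alpha> j" "\<beta> + \<xi> \<notin> \<Delta>\<^sub>p" "\<xi> \<noteq> - \<beta>"
  shows "upper_term p x a b v \<beta> = 0"
proof (cases "\<beta> \<in> \<Delta>\<^sub>p")
  case True
  have "brk G x (eb \<beta> i) = 0" if "i < m \<beta>" for i
  proof (rule ccontr)
    assume "brk G x (eb \<beta> i) \<noteq> 0"
    moreover have "brk G x (eb \<beta> i) \<in> root_space G \<iota> (\<beta> + \<xi>)"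
      using g.brk_root_space[OF iota_part assms(1) eb_root[OF True that]] by (simp add: add.commute)
    ultimately show False using pos_root_shift[OF True assms(2)] assms(3,4) by blast
  qed
  then show ?thesis using True by (simp add: upper_term_def X_simps)
qed (simp add: upper_term_def)

lemma lower_term_vanish:
  assumes x: "x \<in> root_space G \<iota> \<xi>" and \<xi>: "\<xi> = \<alpha> j \<or> \<xi> = - \<alpha> j"
    and \<gamma>: "\<gamma> - \<xi> \<notin> \<Delta>\<^sub>p" "\<gamma> \<noteq> \<xi>"
  shows "lower_term x a b v \<gamma> = 0"
proof (cases "\<gamma> \<in> \<Delta>\<^sub>p")
  case True
  have "brk G x (fb \<gamma> i) = 0" if i: "i < m \<gamma>" for i
  proof (rule ccontr)
    assume nz: "brk G x (fb \<gamma> i) \<noteq> 0"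
    have "\<xi> \<in> dual_space sh"
      using \<xi> contra.simple_roots_dual dual_closed(3) by blast
    then have "\<xi> - \<gamma> \<in> dual_space sh"
      using pos_root_dual[OF True] by (intro dual_closed)
    moreover have "brk G x (fb \<gamma> i) \<in> root_space G \<iota> (\<xi> - \<gamma>)"
      using g.brk_root_space[OF iota_part x fb_root[OF True i]] by simp
    ultimately have "\<xi> - \<gamma> \<in> roots sh G \<iota>"
      using nz \<gamma>(2) unfolding roots_def by auto
    \<comment> \<open>The bracket has weight \<xi> - \<gamma>; passing to the opposite root \<gamma>
      - \<xi> makes \<open>pos_root_shift\<close> applicable with shift - \<xi>.\<close>
    from roots_uminus[OF this] obtain y where "y \<in> root_space G \<iota> (\<gamma> + - \<xi>)" "y \<noteq> 0"
      using g.root_space_0[of \<iota> "\<gamma> - \<xi>"] unfolding roots_def by auto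
    moreover have "- \<xi> = \<alpha> j \<or> - \<xi> = - \<alpha> j" using \<xi> by auto
    ultimately show False using pos_root_shift[OF True] \<gamma> by (metis add_uminus_conv_diff neg_equal_iff_equal)
  qed
  then show ?thesis using True by (simp add: lower_term_def X_simps)
qed (simp add: lower_term_def)

text \<open>For \<beta> = 0 the upper term, and for \<beta> = - \<xi> the lower one, sits at weight
  zero and vanishes, so its partner survives. Elsewhere the two cancel or both vanish.\<close>

lemma upper_plus_lower:
  assumes x: "x \<in> part G p" "x \<in> root_space G \<iota> \<xi>" and \<xi>: "\<xi> = \<alpha> j \<or> \<xi> = - \<alpha> j"
  shows "upper_term p x a b v \<beta> + lower_term x a b v (\<beta> + \<xi>)
    = (if \<beta> = - \<xi> then upper_term p x a b v (- \<xi>) else 0)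
      + (if \<beta> = 0 then lower_term x a b v \<xi> else 0)"
proof -
  have 1: "upper_term p x a b v 0 = 0" "lower_term x a b v 0 = 0"
    using zero_notin_pos_roots by (simp_all add: upper_term_def lower_term_def)
  have "upper_term p x a b v \<beta> + lower_term x a b v (\<beta> + \<xi>) = 0" if "\<beta> \<noteq> - \<xi>" "\<beta> \<noteq> 0"
  proof (cases "\<beta> \<in> \<Delta>\<^sub>p \<and> \<beta> + \<xi> \<in> \<Delta>\<^sub>p")
    case True
    then show ?thesis using upper_lower_cancel[OF x] by blast
  next
    case False
    have "\<xi> \<noteq> - \<beta>" using that(1) by (metis minus_minus)
    then have "upper_term p x a b v \<beta> = 0"
      using upper_term_vanish[OF x(2) \<xi>, of \<beta>] False
      by (cases "\<beta> \<in> \<Delta>\<^sub>p") (auto simp: upper_term_def)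
    moreover have "lower_term x a b v (\<beta> + \<xi>) = 0"
      using lower_term_vanish[OF x(2) \<xi>, of "\<beta> + \<xi>"] False that
      by (cases "\<beta> + \<xi> \<in> \<Delta>\<^sub>p") (auto simp: lower_term_def)
    ultimately show ?thesis by simp
  qed
  then show ?thesis using 1 by auto
qed

text \<open>Each bracket [x, e] is (x, e) times the vector representing \<xi>. Supersymmetry of the
  form cancels the Koszul sign, and the dual basis expansion reassembles x on the left.\<close>

lemma upper_term_boundary:
  assumes x: "x \<in> part G p" "x \<in> root_space G \<iota> \<xi>" and \<xi>: "- \<xi> \<in> \<Delta>\<^sub>p"
  shows "upper_term p x a b v (- \<xi>) = X x a (X (\<iota> (hof \<xi>)) b v)"
proof -
  have "\<xi> \<in> dual_space sh" using pos_root_dual[OF \<xi>] dual_closed(3)[of "- \<xi>"] by simp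
  have eb: "brk G x (eb (- \<xi>) i)
      = smul G (koszul_sign p (root_parity (- \<xi>)) * form (eb (- \<xi>) i) x) (\<iota> (hof \<xi>))"
    if "i < m (- \<xi>)" for i
    using brk_opposite[OF \<open>\<xi> \<in> dual_space sh\<close> x(2) eb_root[OF \<xi> that]]
      inv.form_supersym[OF x(1) eb_part[OF \<xi> that]] by simp
  have "X x a w = (\<Sum>i<m (- \<xi>). sv (form (eb (- \<xi>) i) x) (X (fb (- \<xi>) i) a w))" for w
    by (subst expand_fb[OF \<xi>, of x]) (use x in \<open>simp_all add: X_simps\<close>)
  then show ?thesis
    using \<xi> by (simp add: upper_term_def eb X_simps)
qed

lemma lower_term_boundary:
  assumes x: "x \<in> root_space G \<iota> \<xi>" and \<xi>: "\<xi> \<in> \<Delta>\<^sub>p"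
  shows "lower_term x a b v \<xi> = X (\<iota> (hof \<xi>)) a (X x b v)"
proof -
  have fb: "brk G x (fb \<xi> i) = smul G (form x (fb \<xi> i)) (\<iota> (hof \<xi>))" if "i < m \<xi>" for i
    by (rule brk_opposite[OF pos_root_dual[OF \<xi>] x fb_root[OF \<xi> that]])
  have "X x b v = (\<Sum>i<m \<xi>. sv (form x (fb \<xi> i)) (X (eb \<xi> i) b v))"
    by (subst expand_eb[OF \<xi> x]) (simp add: X_simps)
  then show ?thesis
    using \<xi> by (simp add: lower_term_def fb X_simps)
qed

subsection \<open>Summation over the positive roots\<close>

lemma finite_support:
  obtains K where "finite K" "\<And>\<beta> z. \<beta> \<in> \<Delta>\<^sub>p \<Longrightarrow> \<beta> \<notin> K \<Longrightarrow> z \<in> root_space G \<iota> \<beta> \<Longrightarrow> X z c v = 0"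
proof -
  obtain N where N: "\<forall>\<beta>\<in>\<Delta>\<^sub>p. height \<alpha> \<beta> \<ge> N \<longrightarrow> (\<forall>x\<in>root_space G \<iota> \<beta>. X x c v = 0)"
    using mo.locally_nilpotent by blast
  show ?thesis
  proof (rule that[OF finite_low_roots[of N]])
    fix \<beta> z assume "\<beta> \<in> \<Delta>\<^sub>p" "\<beta> \<notin> {\<beta> \<in> \<Delta>\<^sub>p. height \<alpha> \<beta> < N}" "z \<in> root_space G \<iota> \<beta>"
    then show "X z c v = 0" using N by simp
  qed
qed

lemma finite_root_term: "finite {\<beta>. root_term a b v \<beta> \<noteq> 0}"
proof -
  obtain K where K: "finite K"
    "\<And>\<beta> z. \<beta> \<in> \<Delta>\<^sub>p \<Longrightarrow> \<beta> \<notin> K \<Longrightarrow> z \<in> root_space G \<iota> \<beta> \<Longrightarrow> X z b v = 0" using finite_support[of b v] by metis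
  have "root_term a b v \<beta> = 0" if "\<beta> \<notin> K" for \<beta>
    using K(2)[OF _ that eb_root] by (simp add: root_term_def Omega_root_def X_simps)
  then show ?thesis by (intro finite_subset[OF _ K(1)]) blast
qed

text \<open>The root vector \<open>eb\<close> acts first on v, so local nilpotency kills the term at
  large height whatever x is.\<close>

lemma finite_lower_term: "finite {\<beta>. lower_term x a b v \<beta> \<noteq> 0}"
proof -
  obtain K where K: "finite K"
    "\<And>\<beta> z. \<beta> \<in> \<Delta>\<^sub>p \<Longrightarrow> \<beta> \<notin> K \<Longrightarrow> z \<in> root_space G \<iota> \<beta> \<Longrightarrow> X z b v = 0" using finite_support[of b v] by metis
  have "lower_term x a b v \<beta> = 0" if "\<beta> \<notin> K" for \<beta>
    using K(2)[OF _ that eb_root] by (simp add: lower_term_def X_simps)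
  then show ?thesis by (intro finite_subset[OF _ K(1)]) blast
qed

text \<open>\<open>Sum_any\<close> sums over the support, as \<open>Omega\<close> does, and is 0
  when the support is infinite; hence the finiteness lemmas.\<close>

definition root_sum :: "'b \<Rightarrow> 'b \<Rightarrow> 'v \<Rightarrow> 'v" where
  "root_sum a b v = Sum_any (root_term a b v)"

lemma root_sum_linear:
  "root_sum a b (v + w) = root_sum a b v + root_sum a b w"
  "root_sum a b (sv c v) = sv c (root_sum a b v)"
proof -
  have "root_term a b (v + w) \<beta> = root_term a b v \<beta> + root_term a b w \<beta>" for \<beta>
    by (simp add: root_term_def Omega_root_def X_simps sum.distrib)
  then show "root_sum a b (v + w) = root_sum a b v + root_sum a b w"
    unfolding root_sum_def by (simp add: Sum_any.distrib finite_root_term)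
  have "root_term a b (sv c v) \<beta> = sv c (root_term a b v \<beta>)" for \<beta>
    by (simp add: root_term_def Omega_root_def X_simps mo.V.scale_sum_right)
  moreover have "Sum_any (\<lambda>\<beta>. sv c (root_term a b v \<beta>)) = sv c (Sum_any (root_term a b v))"
  proof -
    have "Sum_any (\<lambda>\<beta>. sv c (root_term a b v \<beta>))
        = (\<Sum>\<beta> | root_term a b v \<beta> \<noteq> 0. sv c (root_term a b v \<beta>))"
      by (rule Sum_any.expand_superset[OF finite_root_term]) auto
    then show ?thesis by (simp add: Sum_any.expand_set mo.V.scale_sum_right)
  qed
  ultimately show "root_sum a b (sv c v) = sv c (root_sum a b v)"
    by (simp add: root_sum_def)
qed

lemma root_sum_0: "root_sum a b 0 = 0"
  using root_sum_linear(2)[of a b 0 0] by simp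

lemma X_root_sum: "X x c (root_sum a b v) = Sum_any (\<lambda>\<beta>. X x c (root_term a b v \<beta>))"
proof -
  let ?K = "{\<beta>. root_term a b v \<beta> \<noteq> 0}"
  have "Sum_any (\<lambda>\<beta>. X x c (root_term a b v \<beta>)) = (\<Sum>\<beta>\<in>?K. X x c (root_term a b v \<beta>))"
    by (rule Sum_any.expand_superset[OF finite_root_term]) (auto simp: X_simps)
  then show ?thesis by (simp add: root_sum_def Sum_any.expand_set X_simps)
qed

text \<open>Translating the lower sum by \<xi> places cancelling terms at the same index; only the
  boundary terms remain.\<close>

lemma root_sum_commutator:
  assumes x: "x \<in> part G p" "x \<in> root_space G \<iota> \<xi>" and \<xi>: "\<xi> = \<alpha> j \<or> \<xi> = - \<alpha> j"
  shows "X x 1 (root_sum a b v)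
    = root_sum a b (X x 1 v) + (upper_term p x a b v (- \<xi>) + lower_term x a b v \<xi>)"
proof -
  let ?L = "lower_term x a b v" and ?U = "upper_term p x a b v"
  let ?Ls = "\<lambda>\<beta>. ?L (\<beta> + \<xi>)"
  have finLs: "finite {\<beta>. ?Ls \<beta> \<noteq> 0}"
  proof (rule finite_subset)
    show "{\<beta>. ?Ls \<beta> \<noteq> 0} \<subseteq> (\<lambda>\<gamma>. \<gamma> - \<xi>) ` {\<gamma>. ?L \<gamma> \<noteq> 0}"
      by (auto simp: image_iff intro!: exI[of _ "_ + \<xi>"])
  qed (intro finite_imageI finite_lower_term)
  note UL = upper_plus_lower[OF x \<xi>, of a b v]
  \<comment> \<open>In an upper term x acts before \<open>fb\<close> but inside the bracket, so
    finiteness is taken from the lower terms: away from - \<xi> and 0 the upper term is minus the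
    translated lower term.\<close>
  have finU: "finite {\<beta>. ?U \<beta> \<noteq> 0}"
  proof (rule finite_subset)
    show "{\<beta>. ?U \<beta> \<noteq> 0} \<subseteq> {\<beta>. ?Ls \<beta> \<noteq> 0} \<union> {- \<xi>, 0}"
    proof
      fix \<beta> assume "\<beta> \<in> {\<beta>. ?U \<beta> \<noteq> 0}"
      then show "\<beta> \<in> {\<beta>. ?Ls \<beta> \<noteq> 0} \<union> {- \<xi>, 0}" using UL[of \<beta>] by (cases "?Ls \<beta> = 0") (auto split: if_splits)
    qed
  qed (use finLs in simp)
  have "Sum_any (\<lambda>\<beta>. ?L \<beta> + ?U \<beta>) = Sum_any ?U + Sum_any ?Ls"
    using Sum_any.distrib[OF finite_lower_term finU] Sum_any_shift[of ?L \<xi>]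
    by (simp add: add.commute)
  also have "\<dots> = Sum_any (\<lambda>\<beta>. ?U \<beta> + ?Ls \<beta>)"
    by (rule Sum_any.distrib[OF finU finLs, symmetric])
  also have "\<dots> = Sum_any (\<lambda>\<beta>. (if \<beta> = - \<xi> then ?U (- \<xi>) else 0) + (if \<beta> = 0 then ?L \<xi> else 0))"
    by (simp only: UL)
  also have "\<dots> = ?U (- \<xi>) + ?L \<xi>"
    by (subst Sum_any.distrib) simp_all
  finally have *: "Sum_any (\<lambda>\<beta>. ?L \<beta> + ?U \<beta>) = ?U (- \<xi>) + ?L \<xi>" .
  have "finite {\<beta>. ?L \<beta> + ?U \<beta> \<noteq> 0}"
    by (rule finite_subset[OF _ finite_UnI[OF finite_lower_term finU]]) auto
  then show ?thesis
    unfolding X_root_sum root_term_commutator[OF x(1)]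
    by (simp add: Sum_any.distrib finite_root_term * root_sum_def)
qed

lemma pos_roots_uminus: "\<beta> \<in> \<Delta>\<^sub>p \<Longrightarrow> - \<beta> \<notin> \<Delta>\<^sub>p"
proof
  assume \<beta>: "\<beta> \<in> \<Delta>\<^sub>p" "- \<beta> \<in> \<Delta>\<^sub>p"
  then obtain k l where k: "\<beta> = simple_comb \<alpha> k" and "- \<beta> = simple_comb \<alpha> l"
    by (auto simp: pos_roots_def)
  then have "simple_comb \<alpha> k = - simple_comb \<alpha> l" by (metis minus_minus)
  then have "\<beta> = 0" using k simple_comb_eq_minus_iff by simp
  with \<beta> zero_notin_pos_roots show False by simp
qed

text \<open>Only the lower boundary term at \<alpha> j remains, since - \<alpha> j is not a positive
  root. For - \<alpha> j, treated next, only the upper one remains.\<close>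

lemma root_sum_E:
  assumes x: "x \<in> part G p" "x \<in> root_space G \<iota> (\<alpha> j)"
  shows "X x 1 (root_sum a b v) = root_sum a b (X x 1 v) + X (\<iota> (hof (\<alpha> j))) a (X x b v)"
proof (cases "x = 0")
  case False
  \<comment> \<open>A nonzero x witnesses that \<alpha> j is a root; for x = 0 both sides
    vanish.\<close>
  then have r: "\<alpha> j \<in> \<Delta>\<^sub>p" using simple_pos_root x(2) by blast
  show ?thesis
    using root_sum_commutator[OF x, of j a b v] lower_term_boundary[OF x(2) r]
      pos_roots_uminus[OF r] by (simp add: upper_term_def)
qed (simp add: X_simps root_sum_0)

lemma root_sum_F:
  assumes x: "x \<in> part G p" "x \<in> root_space G \<iota> (- \<alpha> j)"
  shows "X x 1 (root_sum a b v) = root_sum a b (X x 1 v) + X x a (X (\<iota> (hof (- \<alpha> j))) b v)"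
proof (cases "x = 0")
  case False
  then have r: "\<alpha> j \<in> \<Delta>\<^sub>p" using simple_pos_root x(2) by blast
  show ?thesis
    using root_sum_commutator[OF x, of j a b v] upper_term_boundary[OF x, of a b v]
      pos_roots_uminus[OF r] r by (simp add: lower_term_def)
qed (simp add: X_simps root_sum_0)

text \<open>At weight zero each root cancels by itself: h scales \<open>eb\<close> by \<beta>(h) and
  \<open>fb\<close> by - \<beta>(h).\<close>

lemma root_sum_iota: "X (\<iota> h) 1 (root_sum a b v) = root_sum a b (X (\<iota> h) 1 v)"
proof -
  have "lower_term (\<iota> h) a b v \<beta> + upper_term 0 (\<iota> h) a b v \<beta> = 0" for \<beta>
  proof (cases "\<beta> \<in> \<Delta>\<^sub>p")
    case True
    have "brk G (\<iota> h) (eb \<beta> i) = smul G (\<beta> h) (eb \<beta> i)"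
      "brk G (\<iota> h) (fb \<beta> i) = smul G (- \<beta> h) (fb \<beta> i)" if "i < m \<beta>" for i
      using eb_root[OF True that] fb_root[OF True that] by (simp_all add: root_space_def)
    then show ?thesis using True
      by (simp add: lower_term_def upper_term_def X_simps flip: sum.distrib)
  qed (simp add: lower_term_def upper_term_def)
  then show ?thesis
    unfolding X_root_sum root_term_commutator[OF iota_part] by (simp add: root_sum_def)
qed

section \<open>The Cartan part, the correction by \<rho>, and centrality\<close>

definition cartan_sum :: "'b \<Rightarrow> 'b \<Rightarrow> 'v \<Rightarrow> 'v" where
  "cartan_sum a b v = (\<Sum>i<n. X (\<iota> (hb i)) a (X (\<iota> (hc i)) b v))"

abbreviation "\<Omega> a b v \<equiv> Omega sh G \<iota> \<alpha> form \<rho> hb hc eb fb t sv act a b v"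

lemma Omega_eq:
  "\<Omega> a b v = sv 2 (X (\<iota> (hof \<rho>)) (a * b) v) + cartan_sum a b v + root_sum a b v + root_sum b a v"
proof -
  have "(\<Sum>\<beta> | \<beta> \<in> \<Delta>\<^sub>p \<and> \<Omega>\<^sub>r \<beta> a b v \<noteq> 0. \<Omega>\<^sub>r \<beta> a b v) = root_sum a b v" for a b
    unfolding root_sum_def Sum_any.expand_set
    by (rule sum.cong) (auto simp: root_term_def)
  then show ?thesis by (simp add: Omega_def cartan_sum_def)
qed

lemma Omega_linear: "\<Omega> a b (v + w) = \<Omega> a b v + \<Omega> a b w" "\<Omega> a b (sv c v) = sv c (\<Omega> a b v)"
  by (simp_all add: Omega_eq cartan_sum_def root_sum_linear X_simps mo.V.scale_right_distrib
      mo.V.scale_sum_right sum.distrib mo.V.scale_left_commute ac_simps)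

lemma Omega_diff: "\<Omega> a b (v - w) = \<Omega> a b v - \<Omega> a b w"
  using Omega_linear(1)[of a b "v - w" w] by simp

lemma X_iota_commute:
  assumes "x \<in> part G p" "x \<in> root_space G \<iota> \<xi>"
  shows "X x c (X (\<iota> h) d v) = X (\<iota> h) d (X x c v) - sv (\<xi> h) (X x (c * d) v)"
proof -
  have "brk G x (\<iota> h) = - smul G (\<xi> h) x"
    using assms(2) by (simp add: g.brk_even_antisym root_space_def)
  then show ?thesis
    using X_commute[OF assms(1) iota_part, of c h d v] by (simp add: X_simps)
qed

lemma X_hof:
  assumes "\<xi> \<in> dual_space sh"
  shows "X (\<iota> (hof \<xi>)) c v = (\<Sum>i<n. sv (\<xi> (hb i)) (X (\<iota> (hc i)) c v))"
    and "X (\<iota> (hof \<xi>)) c v = (\<Sum>i<n. sv (\<xi> (hc i)) (X (\<iota> (hb i)) c v))"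
  by (subst h_expand_hc[of "hof \<xi>"] h_expand_hb[of "hof \<xi>"],
      simp add: iota_sum iota_simps X_simps form_hof[OF assms])+

text \<open>Passing the two Cartan factors produces the scalars \<xi>(\<open>hb i\<close>) and
  \<xi>(\<open>hc i\<close>); summed against the dual basis, each family gives the vector
  representing \<xi>.\<close>

lemma cartan_sum_commutator:
  assumes x: "x \<in> part G p" "x \<in> root_space G \<iota> \<xi>" and \<xi>: "\<xi> \<in> dual_space sh"
  shows "X x 1 (cartan_sum a b v)
    = cartan_sum a b (X x 1 v) - X (\<iota> (hof \<xi>)) a (X x b v) - X x a (X (\<iota> (hof \<xi>)) b v)"
proof -
  have "X x 1 (cartan_sum a b v) = (\<Sum>i<n. X (\<iota> (hb i)) a (X (\<iota> (hc i)) b (X x 1 v))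
      - sv (\<xi> (hc i)) (X (\<iota> (hb i)) a (X x b v)) - sv (\<xi> (hb i)) (X x a (X (\<iota> (hc i)) b v)))"
    by (simp add: cartan_sum_def X_simps X_iota_commute[OF x])
  also have "\<dots> = cartan_sum a b (X x 1 v) - X (\<iota> (hof \<xi>)) a (X x b v)
      - X x a (X (\<iota> (hof \<xi>)) b v)"
    by (simp add: sum_subtractf cartan_sum_def X_hof(2)[OF \<xi>, of a] X_hof(1)[OF \<xi>, of b] X_simps)
  finally show ?thesis .
qed

lemma rho_simple: "2 * \<alpha> j (hof \<rho>) = \<alpha> j (hof (\<alpha> j))"
proof -
  have "2 * form (\<iota> (hof \<rho>)) (\<iota> (hof (\<alpha> j))) = form (\<iota> (hof (\<alpha> j))) (\<iota> (hof (\<alpha> j)))"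
    using rho by (simp add: is_rho_def dual_form_def)
  then show ?thesis
    by (simp add: form_iota_commute[of "hof \<rho>"] form_hof contra.simple_roots_dual)
qed

lemma Omega_E: "\<Omega> a b (X (E j) 1 v) = X (E j) 1 (\<Omega> a b v)"
proof -
  note x = E_part[of j] E_root[of j] and d = contra.simple_roots_dual[of j]
  \<comment> \<open>With h representing \<alpha> j, the boundary term h(a)x(b) cancels a Cartan
    term. The other boundary term h(b)x(a) meets - x(a)h(b), leaving [h, x](ab), which the \<rho>
    term compensates.\<close>
  have "X (E j) 1 (\<Omega> a b v) - \<Omega> a b (X (E j) 1 v)
      = sv (\<alpha> j (hof (\<alpha> j))) (X (E j) (a * b) v) - sv (2 * \<alpha> j (hof \<rho>)) (X (E j) (a * b) v)"
    by (simp add: Omega_eq X_simps X_iota_commute[OF x] cartan_sum_commutator[OF x d]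
        root_sum_E[OF x] mo.V.scale_right_diff_distrib mult.commute)
  then show ?thesis by (simp add: rho_simple)
qed

lemma Omega_F: "\<Omega> a b (X (F j) 1 v) = X (F j) 1 (\<Omega> a b v)"
proof -
  note x = F_part[of j] F_root[of j] and d = dual_closed(3)[OF contra.simple_roots_dual[of j]]
  \<comment> \<open>For weight - \<alpha> j the surviving commutator and the \<rho> term both change
    sign.\<close>
  have "X (F j) 1 (\<Omega> a b v) - \<Omega> a b (X (F j) 1 v)
      = sv (2 * \<alpha> j (hof \<rho>)) (X (F j) (a * b) v) - sv (\<alpha> j (hof (\<alpha> j))) (X (F j) (a * b) v)"
    by (simp add: Omega_eq X_simps X_iota_commute[OF x] cartan_sum_commutator[OF x d]
        root_sum_F[OF x] mo.V.scale_right_diff_distrib mo.V.scale_right_distrib mult.commute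
        hof_uminus contra.simple_roots_dual iota_uminus)
  then show ?thesis by (simp add: rho_simple)
qed

lemma Omega_iota: "\<Omega> a b (X (\<iota> h) 1 v) = X (\<iota> h) 1 (\<Omega> a b v)"
proof -
  have "X (\<iota> h) 1 (X (\<iota> (hof \<rho>)) (a * b) v) = X (\<iota> (hof \<rho>)) (a * b) (X (\<iota> h) 1 v)"
    using X_iota_commute[OF iota_part iota_root, of h 1 "hof \<rho>" "a * b" v] by simp
  moreover have "X (\<iota> h) 1 (cartan_sum a b v) = cartan_sum a b (X (\<iota> h) 1 v)"
    using cartan_sum_commutator[OF iota_part iota_root dual_closed(1), of h a b v]
    by (simp add: hof_0 X_simps)
  ultimately show ?thesis by (simp add: Omega_eq X_simps root_sum_iota)
qed

text \<open>The quantifier over v stays inside the induction because the bracket case applies the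
  hypothesis for x to y.v and that for y to x.v.\<close>

lemma Omega_central: "\<forall>v. \<Omega> a b (X x 1 v) = X x 1 (\<Omega> a b v)"
proof (induction x rule: generate_induct)
  case (6 p q x y)
  have "X (brk G x y) 1 v = X x 1 (X y 1 v) - sv (koszul_sign p q) (X y 1 (X x 1 v))" for v
    using X_commute[OF 6(1,2), of 1 1 v] by simp
  then show ?case by (simp add: Omega_diff Omega_linear 6(3,4))
qed (simp_all add: Omega_E Omega_F Omega_iota Omega_linear X_simps)

end

theorem theorem3p2:
  fixes sh :: "complex \<Rightarrow> 'h::ab_group_add \<Rightarrow> 'h"
    and A :: "complex ^ 'i ^ 'i::finite"
    and \<alpha> :: "'i \<Rightarrow> 'h \<Rightarrow> complex" and \<alpha>v :: "'i \<Rightarrow> 'h"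
    and \<tau> :: "'i set"
    and Gt :: "'t::ab_group_add superalg" and \<iota>t :: "'h \<Rightarrow> 't" and e f :: "'i \<Rightarrow> 't"
    and G :: "'g::ab_group_add superalg" and \<pi> :: "'t \<Rightarrow> 'g" and R :: "'t set"
    and \<iota> :: "'h \<Rightarrow> 'g"
    and form :: "'g \<Rightarrow> 'g \<Rightarrow> complex" and \<rho> :: "'h \<Rightarrow> complex"
    and hb hc :: "nat \<Rightarrow> 'h" and eb fb :: "('h \<Rightarrow> complex) \<Rightarrow> nat \<Rightarrow> 'g"
    and sb :: "complex \<Rightarrow> 'b::comm_ring_1 \<Rightarrow> 'b"
    and GB :: "'gb::ab_group_add superalg" and t :: "'g \<Rightarrow> 'b \<Rightarrow> 'gb"
    and sv :: "complex \<Rightarrow> 'v::ab_group_add \<Rightarrow> 'v" and Dv :: "bit \<Rightarrow> 'v set"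
    and act :: "'gb \<Rightarrow> 'v \<Rightarrow> 'v"
    and a b :: 'b
  assumes "contragredient_superalgebra sh A \<alpha> \<alpha>v Gt \<tau> \<iota>t e f G \<pi> R \<iota>"
    and "symmetrizable A"
    and "invariant_form sh G \<iota> form"
    and "is_rho sh \<alpha> \<iota> form \<rho>"
    and "dual_bases_h sh \<iota> form hb hc"
    and "dual_bases_roots sh G \<iota> \<alpha> form eb fb"
    and "loop_superalgebra G sb GB t"
    and "category_O_module sh G \<iota> \<alpha> GB t sv Dv act"
  shows "\<forall>x v. Omega sh G \<iota> \<alpha> form \<rho> hb hc eb fb t sv act a b (act (t x 1) v)
             = act (t x 1) (Omega sh G \<iota> \<alpha> form \<rho> hb hc eb fb t sv act a b v)"
proof -
  interpret contragredient_superalgebra sh A \<alpha> \<alpha>v Gt \<tau> \<iota>t e f G \<pi> R \<iota> by fact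
  interpret inv: invariant_form sh G \<iota> form by fact
  interpret loop: loop_superalgebra G sb GB t by fact
  interpret mo: category_O_module sh G \<iota> \<alpha> GB t sv Dv act by fact
  interpret casimir sh A \<alpha> \<alpha>v Gt \<tau> \<iota>t e f G \<pi> R \<iota> form sb GB t sv Dv act \<rho> hb hc eb fb
    by unfold_locales fact+
  show ?thesis using Omega_central by blast
qed

end
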